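(* Let $d\ge 2$ and let $(\tau_n)_{n\ge0}$ be the $d$-ary search tree process. For any $i\in\mathcal S_d$ and $j\in\{1,\dots,d\}$, $$\lim_{n\to\infty}\frac{|\tau_n^{(ij)}|}{|\tau_n^{(i)}|}=U_{i,j}\quad\text{almost surely},$$ where $(U_{i,1},\dots,U_{i,d})_{i\in\mathcal S_d}$ is a family of i.i.d. Dirichlet random vectors with parameters $a_1=\cdots=a_d=\frac{1}{d-1}$.
   Context: $\mathcal S_d$ is the set of finite words over $\{1,\dots,d\}$, including the empty word $\emptyset$; $ij$ denotes concatenation. A finite $d$-ary tree is a finite set $\tau\subset\mathcal S_d$ containing $\emptyset$ and closed under taking prefixes; $|\tau|$ is its cardinality and $\tau^{(i)}=\{j\in\mathcal S_d: ij\in\tau\}$. The $d$-ary search tree process is the Markov chain on finite $d$-ary trees with $\tau_0=\{\emptyset\}$ and transition probabilities $p(\tau,\tau\sqcup\{v\})=\frac{1}{1+(d-1)|\tau|}$ for each of the $1+(d-1)|\tau|$ nodes $v\in\mathcal S_d\setminus\tau$ such that $\tau\sqcup\{v\}$ is a $d$-ary tree. The Dirichlet distribution with parameters $a_1,\dots,a_d>0$ has density $\frac{1}{\mathbf B(a_1,\dots,a_d)}\prod_{k=1}^d x_k^{a_k-1}$ on the simplex $\{x_1+\cdots+x_d=1,\ x_k\ge0\}$, with $\mathbf B$ the multivariate beta function. *)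

theory Defs
  imports "HOL-Probability.Probability" "HOL-Library.Sublist"
begin

definition dary_words :: "nat \<Rightarrow> nat list set" where
  "dary_words d = lists {1..d}"

definition dary_trees :: "nat \<Rightarrow> nat list set set" where
  "dary_trees d = {t. finite t \<and> t \<subseteq> dary_words d \<and> [] \<in> t \<and> (\<forall>v\<in>t. \<forall>u. prefix u v \<longrightarrow> u \<in> t)}"

definition subtree_at :: "nat \<Rightarrow> nat list set \<Rightarrow> nat list \<Rightarrow> nat list set" where
  "subtree_at d t i = {j \<in> dary_words d. i @ j \<in> t}"

definition search_tree_kernel :: "nat \<Rightarrow> nat list set \<Rightarrow> nat list set \<Rightarrow> real" where
  "search_tree_kernel d t t' =
     (if \<exists>v \<in> dary_words d - t. t' = insert v t \<and> t' \<in> dary_trees d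
      then 1 / (1 + (real d - 1) * real (card t)) else 0)"

text \<open>The Markov chain is described by its elementary conditional probabilities given the whole
  past; the state space is countable, so it carries the discrete sigma-algebra.\<close>

definition search_tree_process :: "'a measure \<Rightarrow> nat \<Rightarrow> (nat \<Rightarrow> 'a \<Rightarrow> nat list set) \<Rightarrow> bool" where
  "search_tree_process M d \<tau> \<longleftrightarrow>
     prob_space M \<and>
     (\<forall>n. \<tau> n \<in> measurable M (count_space (dary_trees d))) \<and>
     (AE \<omega> in M. \<tau> 0 \<omega> = {[]}) \<and>
     (\<forall>n t. \<forall>t' \<in> dary_trees d.
        \<P>(\<omega> in M. \<forall>k\<le>n. \<tau> k \<omega> = t k) > 0 \<longrightarrow>
        \<P>(\<omega> in M. \<tau> (Suc n) \<omega> = t' \<bar> \<forall>k\<le>n. \<tau> k \<omega> = t k)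
          = search_tree_kernel d (t n) t')"

definition multi_beta :: "nat \<Rightarrow> (nat \<Rightarrow> real) \<Rightarrow> real" where
  "multi_beta d a = (\<Prod>k=1..d. Gamma (a k)) / Gamma (\<Sum>k=1..d. a k)"

definition prob_simplex :: "nat \<Rightarrow> (nat \<Rightarrow> real) set" where
  "prob_simplex d = {x \<in> extensional {1..d}. (\<forall>k\<in>{1..d}. 0 \<le> x k) \<and> (\<Sum>k=1..d. x k) = 1}"

text \<open>The reference measure for densities on the simplex: Lebesgue measure in the coordinates
  \<open>x 1, \<dots>, x (d - 1)\<close>, carried by the hyperplane where the coordinates sum to 1.
  Meaningful for \<open>d \<ge> 1\<close>.\<close>

definition hyperplane_measure :: "nat \<Rightarrow> (nat \<Rightarrow> real) measure" where
  "hyperplane_measure d =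
     distr (\<Pi>\<^sub>M k\<in>{1..<d}. lborel) (\<Pi>\<^sub>M k\<in>{1..d}. borel)
       (\<lambda>x. x(d := 1 - (\<Sum>k=1..<d. x k)))"

text \<open>Since \<open>0 powr b = 0\<close> for every \<open>b\<close>, the density below is 0 on the relative boundary of the
  simplex, whatever the parameters; this is a null set.\<close>

definition dirichlet :: "nat \<Rightarrow> (nat \<Rightarrow> real) \<Rightarrow> (nat \<Rightarrow> real) measure" where
  "dirichlet d a =
     density (hyperplane_measure d)
       (\<lambda>x. ennreal (indicator (prob_simplex d) x * (1 / multi_beta d a)
              * (\<Prod>k=1..d. x k powr (a k - 1))))"

lemma sets_dirichlet [measurable_cong, simp]:
  "sets (dirichlet d a) = sets (\<Pi>\<^sub>M k\<in>{1..d}. borel)"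
  by (simp add: dirichlet_def hyperplane_measure_def)

lemma measurable_hyperplane_embedding:
  fixes d :: nat
  assumes "d \<ge> 1"
  shows "(\<lambda>x. x(d := 1 - (\<Sum>k=1..<d. x k)))
           \<in> measurable (\<Pi>\<^sub>M k\<in>{1..<d}. (lborel :: real measure)) (\<Pi>\<^sub>M k\<in>{1..d}. (borel :: real measure))"
proof (rule measurable_PiM_single')
  fix i assume "i \<in> {1..d}"
  then show "(\<lambda>x. (x(d := 1 - (\<Sum>k=1..<d. x k))) i)
      \<in> borel_measurable (\<Pi>\<^sub>M k\<in>{1..<d}. (lborel :: real measure))"
  proof (cases "i = d")
    case False
    with \<open>i \<in> {1..d}\<close> have "i \<in> {1..<d}" by auto
    then have "(\<lambda>x. x i) \<in> measurable (\<Pi>\<^sub>M k\<in>{1..<d}. (lborel :: real measure)) lborel"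
      by (rule measurable_component_singleton)
    with False show ?thesis by (simp add: measurable_lborel2)
  qed simp
next
  show "(\<lambda>x i. (x(d := 1 - (\<Sum>k=1..<d. x k))) i)
      \<in> space (\<Pi>\<^sub>M k\<in>{1..<d}. (lborel :: real measure)) \<rightarrow> (\<Pi>\<^sub>E i\<in>{1..d}. space (borel :: real measure))"
    using assms by (auto simp: space_PiM PiE_def extensional_def)
qed

lemma measurable_dirichlet_density:
  "(\<lambda>x. ennreal (indicator (prob_simplex d) x * (1 / multi_beta d a)
      * (\<Prod>k=1..d. x k powr (a k - 1)))) \<in> borel_measurable (\<Pi>\<^sub>M k\<in>{1..d}. borel)"
proof -
  have "prob_simplex d = {x \<in> space (\<Pi>\<^sub>M k\<in>{1..d}. (borel :: real measure)).
      (\<forall>k\<in>{1..d}. 0 \<le> x k) \<and> (\<Sum>k=1..d. x k) = 1}"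
    by (auto simp: prob_simplex_def space_PiM PiE_def)
  also have "\<dots> \<in> sets (\<Pi>\<^sub>M k\<in>{1..d}. borel)"
    by measurable
  finally have [measurable]: "prob_simplex d \<in> sets (\<Pi>\<^sub>M k\<in>{1..d}. borel)" .
  show ?thesis
    by measurable
qed

end

theory Submission
  imports Defs
begin

text \<open>
  Attach to every node \<open>i\<close> an independent Dirichlet vector \<open>U i\<close> and, given it, an i.i.d.
  sequence of children drawn with probabilities \<open>U i j\<close>; route successive insertions through
  the infinite tree, the \<open>k\<close>-th insertion passing through \<open>i\<close> moving to the \<open>k\<close>-th child drawn
  at \<open>i\<close>. A given growth history of a tree \<open>t\<close> with \<open>n + 1\<close> nodes prescribes finitely many draws at
  each node, so its probability is a product of Dirichlet moments over the nodes of \<open>t\<close>. Since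
  \<open>d a = a + 1\<close> for \<open>a = 1 / (d - 1)\<close>, this product telescopes to the product of
  \<open>a / (a + k)\<close> over \<open>k = 1, \<dots>, n\<close>, whatever the history, which is also its probability under the
  search tree chain. Hence the routed tree process has the law of the search tree process, and for
  the former the limits of the ratios are the \<open>U i j\<close> by the strong law of large numbers. The limits
  are measurable functionals of the path, so the conclusion carries over to the given process.
\<close>

section \<open>Dirichlet integrals\<close>

text \<open>The telescoping rests on \<open>pochhammer a s = a * pochhammer (a + 1) (s - 1)\<close>:
  the factor that a nonroot node with subtree size \<open>s\<close> contributes to the moment
  numerator of its parent leaves one \<open>a\<close> and cancels that node's own denominator
  \<open>pochhammer (real d * a) (s - 1)\<close>. This is where \<open>real d * a = a + 1\<close>,
  hence \<open>a = 1 / (real d - 1)\<close>, is forced. Prescribed draws imply the history, so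
  routing directly yields a lower bound for its probability. A one-sided comparison is enough: two
  probability measures on a countable set that are ordered on singletons coincide. The strong law
  speaks about the number of draws at a node, not about time. Almost sure positivity of all
  Dirichlet coordinates makes every node receive infinitely many draws, so that one can pass from
  the former to the latter. The vectors must live on the given probability space. They are therefore
  defined as limits of the observed ratios, and everything claimed about them becomes a statement
  about the law of the path.\<close>

definition pos_powr :: "real \<Rightarrow> real \<Rightarrow> real" where
  "pos_powr a x = (if x > 0 then x powr (a - 1) else 0)"

lemma pos_powr_nonneg [simp]: "0 \<le> pos_powr a x"
  by (simp add: pos_powr_def)

lemma borel_measurable_pos_powr [measurable]: "pos_powr a \<in> borel_measurable borel"
  unfolding pos_powr_def by measurable

lemma pos_powr_mult: "0 < c \<Longrightarrow> pos_powr a (c * x) = c powr (a - 1) * pos_powr a x"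
  by (auto simp: pos_powr_def powr_mult zero_less_mult_iff)

text \<open>Multiplication by a monomial only shifts the parameter, so every Dirichlet moment is
  another normalizing integral.\<close>

lemma power_times_pos_powr: "x ^ n * pos_powr a x = pos_powr (a + real n) x"
  by (auto simp: pos_powr_def powr_realpow[symmetric] powr_add[symmetric] algebra_simps)

text \<open>The constraints 0 < t < 1 sit in the integrand, as \<open>pos_powr\<close> vanishes off
  the positive half-line; this allows integration over the whole line, and later over all free
  coordinates of the simplex.\<close>

lemma nn_integral_pos_powr_unit:
  assumes "a > 0" "b > 0"
  shows "(\<integral>\<^sup>+ t. ennreal (pos_powr a t * pos_powr b (1 - t)) \<partial>lborel) = ennreal (Beta a b)"
proof -
  have "((\<lambda>t. t powr (a - 1) * (1 - t) powr (b - 1)) has_integral Beta a b) {0<..<1}"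
    using has_integral_Beta_real[OF assms] by (simp add: has_integral_Icc_iff_Ioo)
  then have "((\<lambda>t. pos_powr a t * pos_powr b (1 - t)) has_integral Beta a b) {0<..<1}"
    by (rule has_integral_eq[rotated]) (auto simp: pos_powr_def)
  then have "((\<lambda>t. pos_powr a t * pos_powr b (1 - t)) has_integral Beta a b) UNIV"
    by (rule has_integral_on_superset) (auto simp: pos_powr_def)
  then show ?thesis
    by (intro nn_integral_has_integral_lborel) auto
qed

text \<open>A convolution of truncated powers. Scaling by \<open>s\<close> reduces it to the Beta
  integral; for \<open>s <= 0\<close> the numbers \<open>t\<close> and \<open>s - t\<close> are
  never both positive and both sides vanish.\<close>

lemma nn_integral_pos_powr:
  assumes "a > 0" "b > 0"
  shows "(\<integral>\<^sup>+ t. ennreal (pos_powr a t * pos_powr b (s - t)) \<partial>lborel)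
    = ennreal (Beta a b * pos_powr (a + b) s)"
proof (cases "s > 0")
  case True
  have "(\<integral>\<^sup>+ t. ennreal (pos_powr a t * pos_powr b (s - t)) \<partial>lborel)
      = ennreal s * (\<integral>\<^sup>+ t. ennreal (pos_powr a (s * t) * pos_powr b (s - s * t)) \<partial>lborel)"
    using True by (subst nn_integral_real_affine[where c = s and t = 0]) auto
  also have "(\<integral>\<^sup>+ t. ennreal (pos_powr a (s * t) * pos_powr b (s - s * t)) \<partial>lborel)
      = (\<integral>\<^sup>+ t. ennreal (s powr (a - 1) * s powr (b - 1)) * ennreal (pos_powr a t * pos_powr b (1 - t)) \<partial>lborel)"
  proof (rule nn_integral_cong)
    fix t
    have "s - s * t = s * (1 - t)" by (simp add: algebra_simps)
    then show "ennreal (pos_powr a (s * t) * pos_powr b (s - s * t))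
        = ennreal (s powr (a - 1) * s powr (b - 1)) * ennreal (pos_powr a t * pos_powr b (1 - t))"
      using True by (simp add: pos_powr_mult ennreal_mult[symmetric] mult_ac)
  qed
  also have "\<dots> = ennreal (s powr (a - 1) * s powr (b - 1)) * ennreal (Beta a b)"
    by (subst nn_integral_cmult) (auto simp: nn_integral_pos_powr_unit assms)
  also have "ennreal s * \<dots> = ennreal (s * (s powr (a - 1) * s powr (b - 1)) * Beta a b)"
    using True by (simp add: ennreal_mult'[symmetric] ennreal_mult''[symmetric] mult_ac)
  also have "s * (s powr (a - 1) * s powr (b - 1)) = pos_powr (a + b) s"
    using True by (simp add: pos_powr_def powr_add powr_diff)
  finally show ?thesis by (simp add: mult_ac)
next
  case False
  then have zero: "pos_powr a t * pos_powr b (s - t) = 0" "pos_powr (a + b) s = 0" for t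
    by (auto simp: pos_powr_def)
  show ?thesis unfolding zero by simp
qed

text \<open>The mass \<open>s\<close> is left arbitrary because fixing one coordinate
  \<open>y\<close> replaces it by \<open>s - y\<close>. The inner integral is then a multiple of
  \<open>pos_powr ?A (s - y)\<close>, and the outer one is the convolution above, whose Beta factor
  trades \<open>Gamma ?A\<close> for the Gamma value of the enlarged sum.\<close>

lemma nn_integral_PiM_pos_powr:
  fixes a :: "'i \<Rightarrow> real"
  assumes "finite I" "\<And>i. i \<in> I \<Longrightarrow> a i > 0" "b > 0"
  shows "(\<integral>\<^sup>+ x. ennreal ((\<Prod>i\<in>I. pos_powr (a i) (x i)) * pos_powr b (s - (\<Sum>i\<in>I. x i))) \<partial>(\<Pi>\<^sub>M i\<in>I. lborel))
    = ennreal ((\<Prod>i\<in>I. Gamma (a i)) * Gamma b / Gamma ((\<Sum>i\<in>I. a i) + b) * pos_powr ((\<Sum>i\<in>I. a i) + b) s)"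
  using assms
proof (induction I arbitrary: s rule: finite_induct)
  case empty
  then show ?case by (simp add: nn_integral_count_space PiM_empty Gamma_real_pos[THEN less_imp_neq, symmetric])
next
  case (insert i I)
  interpret product_sigma_finite "\<lambda>_::'i. lborel :: real measure"
    by unfold_locales
  let ?A = "(\<Sum>i\<in>I. a i) + b"
  let ?C = "(\<Prod>i\<in>I. Gamma (a i)) * Gamma b / Gamma ?A"
  have A: "?A > 0" using insert.prems by (intro add_nonneg_pos sum_nonneg) (auto simp: less_imp_le)
  have C: "?C \<ge> 0" using insert.prems A
    by (intro divide_nonneg_pos mult_nonneg_nonneg prod_nonneg) (auto intro!: less_imp_le Gamma_real_pos)
  have "(\<integral>\<^sup>+ x. ennreal ((\<Prod>i\<in>insert i I. pos_powr (a i) (x i)) * pos_powr b (s - (\<Sum>i\<in>insert i I. x i)))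
         \<partial>(\<Pi>\<^sub>M i\<in>insert i I. lborel))
     = (\<integral>\<^sup>+ y. (\<integral>\<^sup>+ x. ennreal ((\<Prod>k\<in>insert i I. pos_powr (a k) ((x(i := y)) k)) * pos_powr b (s - (\<Sum>k\<in>insert i I. (x(i := y)) k)))
         \<partial>(\<Pi>\<^sub>M i\<in>I. lborel)) \<partial>lborel)"
    using insert.hyps by (subst product_nn_integral_insert_rev) auto
  also have "\<dots> = (\<integral>\<^sup>+ y. ennreal (pos_powr (a i) y) * (\<integral>\<^sup>+ x. ennreal ((\<Prod>k\<in>I. pos_powr (a k) (x k)) * pos_powr b ((s - y) - (\<Sum>k\<in>I. x k)))
         \<partial>(\<Pi>\<^sub>M i\<in>I. lborel)) \<partial>lborel)"
  proof (rule nn_integral_cong, goal_cases)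
    case (1 y)
    have P: "(\<Prod>k\<in>I. pos_powr (a k) ((x(i := y)) k)) = (\<Prod>k\<in>I. pos_powr (a k) (x k))"
         "(\<Sum>k\<in>I. (x(i := y)) k) = (\<Sum>k\<in>I. x k)" for x :: "'i \<Rightarrow> real"
      using insert.hyps by (auto intro!: prod.cong sum.cong)
    show ?case
      using insert.hyps
      by (subst nn_integral_cmult[symmetric])
         (auto simp: P ennreal_mult[symmetric] prod_nonneg mult_ac diff_diff_eq fun_upd_same simp del: fun_upd_apply intro!: nn_integral_cong)
  qed
  also have "\<dots> = (\<integral>\<^sup>+ y. ennreal ?C * ennreal (pos_powr (a i) y * pos_powr ?A (s - y)) \<partial>lborel)"
    by (rule nn_integral_cong, subst insert.IH)
       (use insert.prems C in \<open>auto simp: ennreal_mult'[symmetric] mult_ac\<close>)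
  also have "\<dots> = ennreal ?C * ennreal (Beta (a i) ?A * pos_powr (a i + ?A) s)"
    using A insert.prems by (subst nn_integral_cmult) (auto simp: nn_integral_pos_powr)
  also have "\<dots> = ennreal (?C * Beta (a i) ?A * pos_powr (a i + ?A) s)"
    using C by (simp add: ennreal_mult'[symmetric] mult_ac)
  also have "?C * Beta (a i) ?A = (\<Prod>i\<in>insert i I. Gamma (a i)) * Gamma b / Gamma (a i + ?A)"
    using Gamma_real_pos[OF A] insert.hyps by (simp add: Beta_def)
  finally show ?case using insert.hyps by (simp add: add_ac)
qed

lemma multi_beta_pos:
  assumes "d \<ge> 1" "\<And>k. k \<in> {1..d} \<Longrightarrow> a k > 0"
  shows "multi_beta d a > 0"
  unfolding multi_beta_def using assms
  by (intro divide_pos_pos prod_pos Gamma_real_pos sum_pos) auto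

lemma nn_integral_dirichlet:
  assumes d: "d \<ge> 1" and f [measurable]: "f \<in> borel_measurable (\<Pi>\<^sub>M k\<in>{1..d}. borel)"
    and a: "\<And>k. k \<in> {1..d} \<Longrightarrow> a k > 0"
  shows "(\<integral>\<^sup>+ x. f x \<partial>dirichlet d a) = (\<integral>\<^sup>+ x. ennreal (1 / multi_beta d a * ((\<Prod>k\<in>{1..<d}. pos_powr (a k) (x k)) *
      pos_powr (a d) (1 - (\<Sum>k\<in>{1..<d}. x k)))) * f (x(d := 1 - (\<Sum>k=1..<d. x k))) \<partial>(\<Pi>\<^sub>M k\<in>{1..<d}. lborel))"
proof -
  note [measurable] = measurable_hyperplane_embedding[OF d] measurable_dirichlet_density[of d a]
  define g where "g x = ennreal (indicator (prob_simplex d) x * (1 / multi_beta d a)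
              * (\<Prod>k=1..d. x k powr (a k - 1)))" for x
  have [measurable]: "g \<in> borel_measurable (\<Pi>\<^sub>M k\<in>{1..d}. borel)"
    unfolding g_def by measurable
  have [measurable_cong]: "sets (hyperplane_measure d) = sets (\<Pi>\<^sub>M k\<in>{1..d}. borel)"
    by (simp add: hyperplane_measure_def)
  have "(\<integral>\<^sup>+ x. f x \<partial>dirichlet d a) = (\<integral>\<^sup>+ x. g x * f x \<partial>hyperplane_measure d)"
    unfolding dirichlet_def g_def[symmetric]
    by (rule nn_integral_density) measurable
  also have "\<dots> = (\<integral>\<^sup>+ x. g (x(d := 1 - (\<Sum>k=1..<d. x k))) * f (x(d := 1 - (\<Sum>k=1..<d. x k))) \<partial>(\<Pi>\<^sub>M k\<in>{1..<d}. lborel))"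
    unfolding hyperplane_measure_def by (rule nn_integral_distr) measurable
  also have "\<dots> = (\<integral>\<^sup>+ x. ennreal (1 / multi_beta d a * ((\<Prod>k\<in>{1..<d}. pos_powr (a k) (x k)) *
      pos_powr (a d) (1 - (\<Sum>k\<in>{1..<d}. x k)))) * f (x(d := 1 - (\<Sum>k=1..<d. x k))) \<partial>(\<Pi>\<^sub>M k\<in>{1..<d}. lborel))"
  proof (rule nn_integral_cong, goal_cases)
    case (1 x)
    let ?y = "x(d := 1 - (\<Sum>k=1..<d. x k))"
    have D: "{1..d} = insert d {1..<d}" using d by auto
    have ext: "?y \<in> extensional {1..d}" using 1 d by (auto simp: space_PiM PiE_def extensional_def)
    have "(\<Sum>k=1..<d. ?y k) = (\<Sum>k=1..<d. x k)" by (intro sum.cong) auto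
    then have s: "(\<Sum>k=1..d. ?y k) = 1" unfolding D by (subst sum.insert) auto
    have eq: "(\<Prod>k\<in>{1..<d}. pos_powr (a k) (x k)) * pos_powr (a d) (1 - (\<Sum>k\<in>{1..<d}. x k)) = (\<Prod>k=1..d. pos_powr (a k) (?y k))"
      unfolding D by (simp add: mult_ac)
    \<comment> \<open>The embedded point has coordinate sum one, so membership in the simplex is a
      sign condition. A negative coordinate kills a factor on the right just as the indicator kills
      the left.\<close>
    have "indicator (prob_simplex d) ?y * (\<Prod>k=1..d. ?y k powr (a k - 1)) = (\<Prod>k=1..d. pos_powr (a k) (?y k))"
    proof (cases "\<forall>k\<in>{1..d}. 0 \<le> ?y k")
      case True
      then have "?y \<in> prob_simplex d" using ext s by (auto simp: prob_simplex_def)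
      then show ?thesis using True
        by (auto intro!: prod.cong simp: pos_powr_def simp del: fun_upd_apply)
    next
      case False
      then obtain k where "k \<in> {1..d}" "?y k < 0" by (auto simp: not_le simp del: fun_upd_apply)
      then have "pos_powr (a k) (?y k) = 0" by (simp add: pos_powr_def)
      with \<open>k \<in> {1..d}\<close> have "(\<Prod>k=1..d. pos_powr (a k) (?y k)) = 0"
        by (intro prod_zero) (auto simp del: fun_upd_apply)
      moreover have "?y \<notin> prob_simplex d" using False by (auto simp: prob_simplex_def simp del: fun_upd_apply)
      ultimately show ?thesis by simp
    qed
    then have "g ?y = ennreal (1 / multi_beta d a * ((\<Prod>k\<in>{1..<d}. pos_powr (a k) (x k)) *
      pos_powr (a d) (1 - (\<Sum>k\<in>{1..<d}. x k))))" unfolding g_def eq by (simp add: mult_ac)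
    then show ?case by simp
  qed
  finally show ?thesis .
qed

text \<open>With all exponents zero this is the total mass, which yields
  \<open>prob_space_dirichlet\<close>.\<close>

lemma nn_integral_dirichlet_moment:
  assumes d: "d \<ge> 1" and a: "\<And>k. k \<in> {1..d} \<Longrightarrow> a k > 0"
  shows "(\<integral>\<^sup>+ x. ennreal (\<Prod>k=1..d. x k ^ n k) \<partial>dirichlet d a)
    = ennreal (multi_beta d (\<lambda>k. a k + real (n k)) / multi_beta d a)"
proof -
  have D: "{1..d} = insert d {1..<d}" using d by auto
  have mb: "multi_beta d a > 0" using multi_beta_pos[of d a] d a by auto
  have ad: "a d > 0" using a d by auto
  have "(\<integral>\<^sup>+ x. ennreal (\<Prod>k=1..d. x k ^ n k) \<partial>dirichlet d a)
    = (\<integral>\<^sup>+ x. ennreal (1 / multi_beta d a) * ennreal ((\<Prod>k\<in>{1..<d}. pos_powr (a k + n k) (x k)) *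
      pos_powr (a d + n d) (1 - (\<Sum>k\<in>{1..<d}. x k))) \<partial>(\<Pi>\<^sub>M k\<in>{1..<d}. lborel))"
  proof (subst nn_integral_dirichlet[OF d _ a], goal_cases)
    case 3
    show ?case
    proof (rule nn_integral_cong, goal_cases)
      case (1 x)
      let ?S = "1 - (\<Sum>k\<in>{1..<d}. x k)"
      have "(\<Prod>k=1..d. (x(d := ?S)) k ^ n k) = ?S ^ n d * (\<Prod>k\<in>{1..<d}. x k ^ n k)"
        unfolding D by simp
      then have "((\<Prod>k\<in>{1..<d}. pos_powr (a k) (x k)) * pos_powr (a d) ?S) * (\<Prod>k=1..d. (x(d := ?S)) k ^ n k)
        = (\<Prod>k\<in>{1..<d}. x k ^ n k * pos_powr (a k) (x k)) * (?S ^ n d * pos_powr (a d) ?S)"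
        by (simp add: prod.distrib mult_ac)
      then show ?case using mb
        by (simp add: power_times_pos_powr ennreal_mult'[symmetric] ennreal_mult''[symmetric] prod_nonneg del: fun_upd_apply)
    qed
  qed auto
  also have "\<dots> = ennreal (1 / multi_beta d a) * ennreal ((\<Prod>k\<in>{1..<d}. Gamma (a k + n k)) * Gamma (a d + n d) / 
       Gamma ((\<Sum>k\<in>{1..<d}. a k + n k) + (a d + n d)) * pos_powr ((\<Sum>k\<in>{1..<d}. a k + n k) + (a d + n d)) 1)"
    using ad a by (subst nn_integral_cmult, simp, subst nn_integral_PiM_pos_powr) (auto intro!: add_pos_nonneg)
  also have "\<dots> = ennreal (multi_beta d (\<lambda>k. a k + real (n k)) / multi_beta d a)"
  proof -
    have "(\<Prod>k\<in>{1..<d}. Gamma (a k + n k)) * Gamma (a d + n d) / Gamma ((\<Sum>k\<in>{1..<d}. a k + n k) + (a d + n d))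
        = multi_beta d (\<lambda>k. a k + real (n k))"
      unfolding multi_beta_def D by (simp add: add_ac mult_ac)
    moreover have "pos_powr b 1 = 1" for b by (simp add: pos_powr_def)
    ultimately show ?thesis using mb by (simp add: ennreal_mult'[symmetric])
  qed
  finally show ?thesis .
qed

section \<open>Trees grown by routing\<close>

lemma dary_words_simps [simp]:
  "[] \<in> dary_words d"
  "i @ j \<in> dary_words d \<longleftrightarrow> i \<in> dary_words d \<and> j \<in> dary_words d"
  "k # i \<in> dary_words d \<longleftrightarrow> k \<in> {1..d} \<and> i \<in> dary_words d"
  by (auto simp: dary_words_def)

lemma countable_dary_words: "countable (dary_words d)"
  by (rule countable_subset[OF _ countableI_type[of UNIV]]) simp

lemma countable_dary_trees: "countable (dary_trees d)"
proof (rule countable_subset)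
  show "dary_trees d \<subseteq> {t. finite t \<and> t \<subseteq> dary_words d}"
    by (auto simp: dary_trees_def)
  show "countable {t. finite t \<and> t \<subseteq> dary_words d}"
    using countable_Collect_finite_subset[OF countable_dary_words] by simp
qed

lemma dary_trees_prefixD: "t \<in> dary_trees d \<Longrightarrow> v \<in> t \<Longrightarrow> prefix u v \<Longrightarrow> u \<in> t"
  by (auto simp: dary_trees_def)

lemma subtree_at_Nil: "t \<subseteq> dary_words d \<Longrightarrow> subtree_at d t [] = t"
  by (auto simp: subtree_at_def)

lemma finite_subtree_at: "finite t \<Longrightarrow> finite (subtree_at d t i)"
proof -
  assume "finite t"
  have "inj_on ((@) i) (subtree_at d t i)" by (auto simp: inj_on_def)
  moreover have "(@) i ` subtree_at d t i \<subseteq> t" by (auto simp: subtree_at_def)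
  ultimately show ?thesis using \<open>finite t\<close> by (metis finite_imageD finite_subset)
qed

lemma subtree_at_eq_empty:
  assumes "t \<in> dary_trees d" "i \<notin> t"
  shows "subtree_at d t i = {}"
  using assms by (auto simp: subtree_at_def dary_trees_def)

lemma card_subtree_at_pos_iff:
  assumes "t \<in> dary_trees d"
  shows "0 < card (subtree_at d t i) \<longleftrightarrow> i \<in> t"
proof
  assume "i \<in> t"
  then have "[] \<in> subtree_at d t i" by (simp add: subtree_at_def)
  then show "0 < card (subtree_at d t i)"
    using finite_subtree_at[of t d i] assms by (auto simp: card_gt_0_iff dary_trees_def)
qed (use subtree_at_eq_empty[OF assms] in force)

lemma card_subtree_at_insert:
  assumes "finite t" "v \<notin> t" "v \<in> dary_words d"
  shows "card (subtree_at d (insert v t) i) = card (subtree_at d t i) + of_bool (prefix i v)"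
proof (cases "prefix i v")
  case True
  then obtain w where w: "v = i @ w" by (auto simp: prefix_def)
  then have "subtree_at d (insert v t) i = insert w (subtree_at d t i)" "w \<notin> subtree_at d t i"
    using assms by (auto simp: subtree_at_def)
  then show ?thesis using True finite_subtree_at[OF assms(1)] by simp
next
  case False
  then have "subtree_at d (insert v t) i = subtree_at d t i"
    by (auto simp: subtree_at_def)
  then show ?thesis using False by simp
qed

text \<open>The size of the subtree at a node after \<open>m - 1\<close> insertions, when the \<open>k\<close>-th
  insertion passing through node \<open>i\<close> is routed to its child \<open>c i k\<close>. Nodes are read backwards
  to make the recursion structural.\<close>

primrec routed_size_rev :: "(nat list \<Rightarrow> nat \<Rightarrow> nat) \<Rightarrow> nat \<Rightarrow> nat list \<Rightarrow> nat" where
  "routed_size_rev c m [] = m"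
| "routed_size_rev c m (j # w) = card {k. k < routed_size_rev c m w - 1 \<and> c (rev w) k = j}"

definition routed_size :: "(nat list \<Rightarrow> nat \<Rightarrow> nat) \<Rightarrow> nat \<Rightarrow> nat list \<Rightarrow> nat" where
  "routed_size c m i = routed_size_rev c m (rev i)"

definition routed_tree :: "nat \<Rightarrow> (nat list \<Rightarrow> nat \<Rightarrow> nat) \<Rightarrow> nat \<Rightarrow> nat list set" where
  "routed_tree d c n = {i \<in> dary_words d. 0 < routed_size c (Suc n) i}"

section \<open>Sizes of subtrees under routing\<close>

lemma routed_size_simps [simp]:
  "routed_size c m [] = m"
  "routed_size c m (i @ [j]) = card {k. k < routed_size c m i - 1 \<and> c i k = j}"
  by (simp_all add: routed_size_def)

text \<open>One is lost because the first of the nodes counted at \<open>i\<close> is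
  \<open>i\<close> itself, which draws no child. Sizes thus drop strictly along any path of nonempty
  subtrees.\<close>

lemma routed_size_child_le: "routed_size c m (i @ [j]) \<le> routed_size c m i - 1"
proof -
  have "card {k. k < routed_size c m i - 1 \<and> c i k = j} \<le> card {..<routed_size c m i - 1}"
    by (intro card_mono) auto
  then show ?thesis by simp
qed

lemma routed_size_append_le: "routed_size c m (i @ w) \<le> routed_size c m i"
proof (induction w rule: rev_induct)
  case (snoc j w)
  then show ?case using routed_size_child_le[of c m "i @ w" j] by simp
qed simp

lemma sum_card_fibres:
  assumes "\<And>k. f k \<in> A" "finite A"
  shows "(\<Sum>j\<in>A. card {k. k < (m::nat) \<and> f k = j}) = m"
proof -
  have "(\<Union>j\<in>A. {k. k < m \<and> f k = j}) = {..<m}" using assms by auto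
  moreover have "card (\<Union>j\<in>A. {k. k < m \<and> f k = j}) = (\<Sum>j\<in>A. card {k. k < m \<and> f k = j})"
    using assms by (intro card_UN_disjoint) auto
  ultimately show ?thesis by simp
qed

text \<open>Words have unbounded length, so the induction runs on the size at \<open>i\<close>,
  which is strictly smaller at each child. The draws at \<open>i\<close> distribute all but one of
  the counted nodes among the children, and \<open>i\<close> itself restores the missing
  one.\<close>

lemma card_routed_descendants:
  assumes c: "\<And>i k. i \<in> dary_words d \<Longrightarrow> c i k \<in> {1..d}" and i: "i \<in> dary_words d"
  shows "finite {w \<in> dary_words d. 0 < routed_size c m (i @ w)} \<and>
    card {w \<in> dary_words d. 0 < routed_size c m (i @ w)} = routed_size c m i"
  using i
proof (induction "routed_size c m i" arbitrary: i rule: less_induct)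
  case less
  let ?S = "\<lambda>i. {w \<in> dary_words d. 0 < routed_size c m (i @ w)}"
  show ?case
  proof (cases "routed_size c m i = 0")
    case True
    then have S: "?S i = {}" using routed_size_append_le[of c m i] by auto
    show ?thesis unfolding S by (simp add: True)
  next
    case False
    have IH: "finite (?S (i @ [j])) \<and> card (?S (i @ [j])) = routed_size c m (i @ [j])" if "j \<in> {1..d}" for j
      using that less.prems False routed_size_child_le[of c m i j] by (intro less.hyps) auto
    have S: "?S i = insert [] (\<Union>j\<in>{1..d}. (#) j ` ?S (i @ [j]))" (is "_ = insert [] ?U")
    proof (intro equalityI subsetI)
      fix w assume "w \<in> ?S i"
      then show "w \<in> insert [] ?U" by (cases w) auto
    next
      fix w assume "w \<in> insert [] ?U"
      then show "w \<in> ?S i" using False by auto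
    qed
    have fin: "finite ?U" using IH by auto
    have "card ?U = (\<Sum>j\<in>{1..d}. card ((#) j ` ?S (i @ [j])))"
      using IH by (intro card_UN_disjoint) auto
    also have "\<dots> = (\<Sum>j\<in>{1..d}. routed_size c m (i @ [j]))"
      using IH by (intro sum.cong refl) (simp add: card_image)
    also have "\<dots> = routed_size c m i - 1"
      using c[OF less.prems] by (simp del: One_nat_def add: sum_card_fibres)
    finally have "card (?S i) = Suc (routed_size c m i - 1)"
      unfolding S using fin by (subst card_insert_disjoint) auto
    then show ?thesis using fin False unfolding S by simp
  qed
qed

lemma
  assumes "\<And>i k. i \<in> dary_words d \<Longrightarrow> c i k \<in> {1..d}"
  shows card_subtree_at_routed_tree: "i \<in> dary_words d \<Longrightarrow>
      card (subtree_at d (routed_tree d c n) i) = routed_size c (Suc n) i"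
    and routed_tree_in_dary_trees: "routed_tree d c n \<in> dary_trees d"
proof -
  show "card (subtree_at d (routed_tree d c n) i) = routed_size c (Suc n) i" if "i \<in> dary_words d"
    using card_routed_descendants[OF assms that, where m = "Suc n"] that
    by (simp add: subtree_at_def routed_tree_def)
  have "finite (routed_tree d c n)"
    using card_routed_descendants[of d c "[]" "Suc n", OF assms] by (simp add: routed_tree_def)
  moreover have "u \<in> routed_tree d c n" if v: "v \<in> routed_tree d c n" "prefix u v" for u v
  proof -
    obtain w where "v = u @ w" using v(2) by (auto simp: prefix_def)
    then show ?thesis using v(1) routed_size_append_le[of c "Suc n" u w] by (auto simp: routed_tree_def)
  qed
  moreover have "routed_tree d c n \<subseteq> dary_words d" "[] \<in> routed_tree d c n"
    by (auto simp: routed_tree_def)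
  ultimately show "routed_tree d c n \<in> dary_trees d"
    unfolding dary_trees_def by blast
qed

section \<open>Growth histories and the draws that they prescribe\<close>

definition growth_step :: "nat \<Rightarrow> nat list set \<Rightarrow> nat list set \<Rightarrow> bool" where
  "growth_step d t t' \<longleftrightarrow> (\<exists>v\<in>dary_words d - t. t' = insert v t \<and> t' \<in> dary_trees d)"

definition growth_history :: "nat \<Rightarrow> (nat \<Rightarrow> nat list set) \<Rightarrow> nat \<Rightarrow> bool" where
  "growth_history d t n \<longleftrightarrow> t 0 = {[]} \<and> (\<forall>m<n. growth_step d (t m) (t (Suc m)))"

lemma growth_history_Suc:
  "growth_history d t (Suc n) \<longleftrightarrow> growth_history d t n \<and> growth_step d (t n) (t (Suc n))"
  by (auto simp: growth_history_def less_Suc_eq)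

lemma growth_history_dary_trees:
  assumes "growth_history d t n" "m \<le> n"
  shows "t m \<in> dary_trees d"
proof (cases m)
  case 0
  then show ?thesis using assms by (simp add: growth_history_def dary_trees_def)
next
  case (Suc l)
  then show ?thesis using assms by (auto simp: growth_history_def growth_step_def)
qed

lemma card_growth_history:
  assumes "growth_history d t n" "m \<le> n"
  shows "card (t m) = Suc m"
  using assms(2)
proof (induction m)
  case 0
  then show ?case using assms by (simp add: growth_history_def)
next
  case (Suc m)
  then have "growth_step d (t m) (t (Suc m))" using assms by (simp add: growth_history_def)
  moreover have "finite (t m)"
    using growth_history_dary_trees[OF assms(1), of m] Suc.prems by (simp add: dary_trees_def)
  ultimately show ?case using Suc by (auto simp: growth_step_def)
qed

lemma growth_history_mono:
  assumes "growth_history d t n" "m \<le> n"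
  shows "t m \<subseteq> t n"
  using assms
proof (induction n)
  case (Suc n)
  then show ?case
    by (cases "m = Suc n") (auto simp: growth_history_Suc growth_step_def)
qed simp

text \<open>The witness records, at each node, the children through which the successive insertions
  leave it. Positions that are never read also get values in {1..d}, as
  \<open>emeasure_routing_prefix\<close> demands.\<close>

lemma growth_history_routing:
  assumes "growth_history d t n" "d \<ge> 1"
  shows "\<exists>x. (\<forall>i k. x i k \<in> {1..d}) \<and> (\<forall>m\<le>n. \<forall>i. \<forall>j\<in>{1..d}.
    card {k. k < card (subtree_at d (t m) i) - 1 \<and> x i k = j} = card (subtree_at d (t m) (i @ [j])))"
  using assms
proof (induction n)
  case 0
  have "subtree_at d {[]} (i @ [j]) = {}" for i j by (auto simp: subtree_at_def)
  \<comment> \<open>Only the root is present and it has size one, so no draw has been read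
    yet.\<close>
  moreover have "card (subtree_at d {[]} i) - 1 = 0" for i
  proof -
    have "subtree_at d {[]} i \<subseteq> {[]}" by (auto simp: subtree_at_def)
    from card_mono[OF _ this] show ?thesis by simp
  qed
  ultimately show ?case using 0
    by (intro exI[of _ "\<lambda>_ _. 1"]) (auto simp: growth_history_def)
next
  case (Suc n)
  let ?s = "\<lambda>m i. card (subtree_at d (t m) i)"
  from Suc.prems have hist: "growth_history d t n" and step: "growth_step d (t n) (t (Suc n))"
    by (auto simp: growth_history_Suc)
  from step obtain v where v: "v \<in> dary_words d" "v \<notin> t n" "t (Suc n) = insert v (t n)"
    by (auto simp: growth_step_def)
  have trees: "t m \<in> dary_trees d" if "m \<le> Suc n" for m
    using growth_history_dary_trees[OF Suc.prems(1) that] .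
  then have fin: "finite (t m)" if "m \<le> Suc n" for m
    using that by (auto simp: dary_trees_def)
  have size_Suc: "?s (Suc n) i = ?s n i + of_bool (prefix i v)" for i
    using card_subtree_at_insert[OF fin[of n] v(2,1)] v(3) by simp
  have size_mono: "?s m i \<le> ?s n i" if "m \<le> n" for m i
    using growth_history_mono[OF hist that] finite_subtree_at[OF fin[of n]]
    by (intro card_mono) (auto simp: subtree_at_def)
  from Suc.IH[OF hist Suc.prems(2)] obtain x where
    x1: "\<forall>i k. x i k \<in> {1..d}" and
    x2: "\<forall>m\<le>n. \<forall>i. \<forall>j\<in>{1..d}. card {k. k < ?s m i - 1 \<and> x i k = j} = ?s m (i @ [j])"
    by (elim exE conjE)
  have x: "card {k. k < ?s m i - 1 \<and> x i k = j} = ?s m (i @ [j])" if "m \<le> n" "j \<in> {1..d}" for m i j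
    using x2 that by blast
  \<comment> \<open>The insertion of \<open>v\<close> is draw number \<open>?s n i - 1\<close> at
    each proper prefix \<open>i\<close> of \<open>v\<close>, and it follows the next letter of
    \<open>v\<close>. Up to time \<open>n\<close> only positions below \<open>?s n i - 1\<close> are
    read, so the earlier equations survive the change.\<close>
  define x' where "x' i k = (if k = ?s n i - 1 \<and> strict_prefix i v then v ! length i else x i k)" for i k
  have "x' i k \<in> {1..d}" for i k
  proof -
    have "strict_prefix i v \<Longrightarrow> v ! length i \<in> {1..d}"
      using v(1) prefix_length_less[of i v] nth_mem[of "length i" v] by (auto simp: dary_words_def)
    then show ?thesis using x1 by (auto simp: x'_def)
  qed
  moreover have old: "{k. k < p \<and> x' i k = j} = {k. k < p \<and> x i k = j}" if "p \<le> ?s n i - 1" for i j p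
    using that by (auto simp: x'_def)
  have "card {k. k < ?s m i - 1 \<and> x' i k = j} = ?s m (i @ [j])" if m: "m \<le> Suc n" and j: "j \<in> {1..d}" for m i j
  proof (cases "m = Suc n")
    case False
    then have "m \<le> n" using m by simp
    then show ?thesis using x[OF _ j, of m i] old[of "?s m i - 1" i j] size_mono[of m i] by simp
  next
    case m: True
    show ?thesis
    proof (cases "prefix i v")
      case False
      then have "\<not> prefix (i @ [j]) v" by (auto simp: prefix_def)
      then show ?thesis using False x[OF _ j, of n i] by (simp add: m size_Suc old)
    next
      case pref: True
      show ?thesis
      proof (cases "i = v")
        case True
        \<comment> \<open>The node just created has size one, hence reads no draw, and its children
          are still empty.\<close>
        have "v @ [j] \<notin> t n"
          using dary_trees_prefixD[OF trees[of n], of "v @ [j]" v] v(2) by auto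
        then have "?s n v = 0" "?s n (v @ [j]) = 0"
          using subtree_at_eq_empty[OF trees[of n]] v(2) by simp_all
        then show ?thesis by (simp add: m size_Suc True)
      next
        case False
        then have strict: "strict_prefix i v" using pref by (simp add: strict_prefix_def)
        then have "i \<in> t n" using dary_trees_prefixD[OF trees[of "Suc n"] _ pref] v(3) False by auto
        then have pos: "0 < ?s n i" using card_subtree_at_pos_iff[OF trees[of n]] by simp
        let ?p = "?s n i - 1"
        \<comment> \<open>The new draw is split off from the old ones. It counts for
          \<open>j\<close> exactly when the next letter of \<open>v\<close> is \<open>j\<close>,
          which is also when the subtree at \<open>i @ [j]\<close> grows.\<close>
        have "{k. k < ?s m i - 1 \<and> x' i k = j} = {k. k < ?p \<and> x i k = j} \<union> {k. k = ?p \<and> x' i k = j}"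
          using pos pref by (auto simp: m size_Suc x'_def)
        moreover have "{k. k = ?p \<and> x' i k = j} = (if v ! length i = j then {?p} else {})"
          using strict by (auto simp: x'_def)
        moreover have "prefix (i @ [j]) v \<longleftrightarrow> v ! length i = j"
        proof -
          from strict obtain k w where "v = i @ k # w" by (auto elim: strict_prefixE')
          then show ?thesis by auto
        qed
        ultimately show ?thesis using x[OF _ j, of n i] by (simp add: m size_Suc)
      qed
    qed
  qed
  ultimately show ?case by (intro exI[of _ x'] conjI allI impI ballI)
qed

text \<open>Agreement is required only on the draws read by time \<open>n\<close>, so the history
  holds on a cylinder event over finitely many nodes. Sizes are matched from the root down: at the
  root both equal \<open>Suc m\<close>, and below it they are counts of the same draws.\<close>

lemma routed_tree_eq_history:
  assumes hist: "growth_history d t n"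
    and x: "\<And>m i j. m \<le> n \<Longrightarrow> j \<in> {1..d} \<Longrightarrow>
      card {k. k < card (subtree_at d (t m) i) - 1 \<and> x i k = j} = card (subtree_at d (t m) (i @ [j]))"
    and c: "\<And>i k. i \<in> t n \<Longrightarrow> k < card (subtree_at d (t n) i) - 1 \<Longrightarrow> c i k = x i k"
    and m: "m \<le> n"
  shows "routed_tree d c m = t m"
proof -
  have trees: "t l \<in> dary_trees d" if "l \<le> n" for l
    using growth_history_dary_trees[OF hist that] .
  have sub: "subtree_at d (t m) i \<subseteq> subtree_at d (t n) i" for i
    using growth_history_mono[OF hist m] by (auto simp: subtree_at_def)
  have le: "card (subtree_at d (t m) i) \<le> card (subtree_at d (t n) i)" for i
    using sub finite_subtree_at[of "t n"] trees[of n] by (intro card_mono) (auto simp: dary_trees_def)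
  have cx: "c i k = x i k" if "k < card (subtree_at d (t m) i) - 1" for i k
  proof -
    have "i \<in> t n" using that le[of i] card_subtree_at_pos_iff[OF trees[of n], of i] by auto
    then show ?thesis using that le[of i] by (intro c) auto
  qed
  have size: "routed_size c (Suc m) i = card (subtree_at d (t m) i)" if "i \<in> dary_words d" for i
    using that
  proof (induction i rule: rev_induct)
    case Nil
    have "t m \<subseteq> dary_words d" using trees[OF m] by (simp add: dary_trees_def)
    then show ?case using card_growth_history[OF hist m] by (simp add: subtree_at_Nil)
  next
    case (snoc j i)
    have "{k. k < card (subtree_at d (t m) i) - 1 \<and> c i k = j} = {k. k < card (subtree_at d (t m) i) - 1 \<and> x i k = j}"
      using cx by auto
    then show ?case using snoc x[OF m, of j i] by simp
  qed
  have "t m \<subseteq> dary_words d" using trees[OF m] by (simp add: dary_trees_def)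
  then show ?thesis
    unfolding routed_tree_def using size card_subtree_at_pos_iff[OF trees[OF m]] by auto
qed

section \<open>Products over the nodes of a tree\<close>

text \<open>A child slot missing from \<open>t\<close> has size zero and contributes
  \<open>h 0 = 1\<close>; the occupied slots are exactly the nodes other than the root, each with a
  unique parent.\<close>

lemma prod_children:
  fixes h :: "nat \<Rightarrow> 'b :: comm_monoid_mult"
  assumes t: "t \<in> dary_trees d" and h: "h 0 = 1"
  shows "(\<Prod>i\<in>t. \<Prod>j=1..d. h (card (subtree_at d t (i @ [j])))) = (\<Prod>w\<in>t - {[]}. h (card (subtree_at d t w)))"
proof -
  let ?g = "\<lambda>w. h (card (subtree_at d t w))"
  have fin: "finite t" using t by (simp add: dary_trees_def)
  have inj: "inj_on (\<lambda>(i, j). i @ [j]) A" for A :: "(nat list \<times> nat) set"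
    by (auto simp: inj_on_def)
  have "(\<Prod>i\<in>t. \<Prod>j=1..d. ?g (i @ [j])) = (\<Prod>(i, j)\<in>t \<times> {1..d}. ?g (i @ [j]))"
    by (rule prod.cartesian_product)
  also have "\<dots> = (\<Prod>w\<in>(\<lambda>(i, j). i @ [j]) ` (t \<times> {1..d}). ?g w)"
    by (subst prod.reindex[OF inj]) (auto intro!: prod.cong)
  also have "\<dots> = (\<Prod>w\<in>t - {[]}. ?g w)"
  proof (rule prod.mono_neutral_right)
    show "t - {[]} \<subseteq> (\<lambda>(i, j). i @ [j]) ` (t \<times> {1..d})"
    proof
      fix w assume w: "w \<in> t - {[]}"
      then obtain i j where ij: "w = i @ [j]" by (metis DiffD2 insertI1 rev_exhaust)
      then have "i \<in> t" "j \<in> {1..d}" using w t by (auto simp: dary_trees_def)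
      then show "w \<in> (\<lambda>(i, j). i @ [j]) ` (t \<times> {1..d})" using ij by force
    qed
    show "\<forall>w\<in>(\<lambda>(i, j). i @ [j]) ` (t \<times> {1..d}) - (t - {[]}). ?g w = 1"
    proof
      fix w assume "w \<in> (\<lambda>(i, j). i @ [j]) ` (t \<times> {1..d}) - (t - {[]})"
      then have "w \<notin> t" by auto
      then show "?g w = 1" using subtree_at_eq_empty[OF t] h by simp
    qed
  qed (use fin in auto)
  finally show ?thesis .
qed

lemma prod_pochhammer_tree:
  fixes a :: real
  assumes t: "t \<in> dary_trees d" and a: "a > 0"
  shows "(\<Prod>i\<in>t. (\<Prod>j=1..d. pochhammer a (card (subtree_at d t (i @ [j])))) /
      pochhammer (a + 1) (card (subtree_at d t i) - 1)) = a ^ (card t - 1) / pochhammer (a + 1) (card t - 1)"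
proof -
  let ?s = "\<lambda>i. card (subtree_at d t i)"
  let ?q = "\<lambda>i. pochhammer (a + 1) (?s i - 1)"
  have fin: "finite t" and nil: "[] \<in> t" and sub: "t \<subseteq> dary_words d" using t by (auto simp: dary_trees_def)
  have q: "?q i \<noteq> 0" for i using a pochhammer_pos[of "a + 1" "?s i - 1"] by simp
  have "(\<Prod>i\<in>t. \<Prod>j=1..d. pochhammer a (?s (i @ [j]))) = (\<Prod>w\<in>t - {[]}. pochhammer a (?s w))"
    by (rule prod_children[OF t]) simp
  also have "\<dots> = (\<Prod>w\<in>t - {[]}. a * ?q w)"
  proof (rule prod.cong[OF refl])
    fix w assume "w \<in> t - {[]}"
    then have "0 < ?s w" using card_subtree_at_pos_iff[OF t] by auto
    \<comment> \<open>Peeling off the first factor is possible because the subtree at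
      \<open>w\<close> is nonempty; what remains is the denominator belonging to \<open>w\<close>
      itself.\<close>
    then show "pochhammer a (?s w) = a * ?q w"
      using pochhammer_rec[of a "?s w - 1"] by simp
  qed
  also have "\<dots> = a ^ (card t - 1) * (\<Prod>w\<in>t - {[]}. ?q w)"
    using nil by (simp add: prod.distrib)
  finally have "(\<Prod>i\<in>t. \<Prod>j=1..d. pochhammer a (?s (i @ [j]))) = a ^ (card t - 1) * (\<Prod>w\<in>t - {[]}. ?q w)" .
  \<comment> \<open>The root is nobody's child, so its denominator is the one that stays
    uncancelled.\<close>
  moreover have "(\<Prod>w\<in>t. ?q w) = pochhammer (a + 1) (card t - 1) * (\<Prod>w\<in>t - {[]}. ?q w)"
    using prod.remove[OF fin nil, of ?q] sub by (simp add: subtree_at_Nil)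
  moreover have "(\<Prod>w\<in>t - {[]}. ?q w) \<noteq> 0" using q fin by (simp add: prod_zero_iff)
  ultimately show ?thesis by (simp add: prod_dividef)
qed

section \<open>Independent draws from a Dirichlet vector\<close>

text \<open>For bounded variables Hoeffding's inequality makes the deviation probabilities
  geometrically small in \<open>m\<close>, so Borel-Cantelli gives almost sure convergence along all
  \<open>m\<close> at once.\<close>

lemma (in prob_space) strong_law_unit_interval:
  fixes X :: "nat \<Rightarrow> 'a \<Rightarrow> real"
  assumes indep: "indep_vars (\<lambda>_. borel) X UNIV"
    and bnd: "\<And>k. AE \<omega> in M. X k \<omega> \<in> {0..1}"
    and mean: "\<And>k. expectation (X k) = p"
  shows "AE \<omega> in M. (\<lambda>m. (\<Sum>k<m. X k \<omega>) / real m) \<longlonglongrightarrow> p"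
proof -
  have rv [measurable]: "random_variable borel (X k)" for k
    using indep by (auto simp: indep_vars_def)
  have *: "AE \<omega> in M. \<forall>\<^sub>F m in sequentially. \<bar>(\<Sum>k<m. X k \<omega>) - real m * p\<bar> < real m * e" if e: "e > 0" for e
  proof -
    let ?A = "\<lambda>m. {\<omega>\<in>space M. \<bar>(\<Sum>k<m. X k \<omega>) - real m * p\<bar> \<ge> real m * e}"
    have bound: "prob (?A m) \<le> 2 * exp (- 2 * e\<^sup>2) ^ m" for m
    proof (cases "m = 0")
      case True
      then show ?thesis by (simp add: prob_space)
    next
      case False
      have ind: "indep_vars (\<lambda>_. borel) X {..<m}"
        using indep by (rule indep_vars_subset) auto
      interpret Hoeffding_ineq M "{..<m}" X "\<lambda>_. 0" "\<lambda>_. 1" "real m * p"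
        by unfold_locales (use bnd ind in \<open>auto simp: mean\<close>)
      have "prob (?A m) \<le> 2 * exp (- 2 * (real m * e)\<^sup>2 / real m)"
        using Hoeffding_ineq_abs_ge[of "real m * e"] e False by simp
      also have "- 2 * (real m * e)\<^sup>2 / real m = real m * (- 2 * e\<^sup>2)"
        using False by (simp add: power2_eq_square)
      finally show ?thesis by (simp only: exp_of_nat_mult)
    qed
    have "summable (\<lambda>m. 2 * exp (- 2 * e\<^sup>2) ^ m)"
      using e by (intro summable_mult summable_geometric) simp
    then have "summable (\<lambda>m. prob (?A m))"
      by (rule summable_comparison_test'[where N = 0]) (use bound in auto)
    then have "AE \<omega> in M. \<forall>\<^sub>F m in sequentially. \<omega> \<in> space M - ?A m"
      by (intro borel_cantelli_AE1) (auto simp: emeasure_eq_measure)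
    then show ?thesis
      by eventually_elim (auto elim!: eventually_mono simp: not_le)
  qed
  \<comment> \<open>The null set depends on the tolerance, so the quantifier is moved inside only
    for the countable family of tolerances \<open>inverse (real (Suc q))\<close>.\<close>
  have "AE \<omega> in M. \<forall>q. \<forall>\<^sub>F m in sequentially. \<bar>(\<Sum>k<m. X k \<omega>) - real m * p\<bar> < real m * inverse (real (Suc q))"
    by (subst AE_all_countable) (intro allI *, simp)
  then show ?thesis
  proof eventually_elim
    case (elim \<omega>)
    show ?case
    proof (rule tendstoI)
      fix e :: real assume "e > 0"
      then obtain q where q: "inverse (real (Suc q)) < e" using reals_Archimedean by blast
      show "\<forall>\<^sub>F m in sequentially. dist ((\<Sum>k<m. X k \<omega>) / real m) p < e"
        using spec[OF elim, of q] eventually_gt_at_top[of 0]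
      proof eventually_elim
        case (elim m)
        have "\<bar>(\<Sum>k<m. X k \<omega>) - real m * p\<bar> / real m < inverse (real (Suc q))"
          using elim by (simp add: divide_less_eq mult.commute)
        also have "\<bar>(\<Sum>k<m. X k \<omega>) - real m * p\<bar> / real m = \<bar>((\<Sum>k<m. X k \<omega>) - real m * p) / real m\<bar>"
          by (simp add: abs_divide)
        also have "((\<Sum>k<m. X k \<omega>) - real m * p) / real m = (\<Sum>k<m. X k \<omega>) / real m - p"
          using elim(2) by (simp add: diff_divide_distrib)
        finally show ?case using q by (simp add: dist_real_def)
      qed
    qed
  qed
qed

lemma indep_vars_PiM_component:
  assumes "\<And>i. i \<in> I \<Longrightarrow> prob_space (M i)" "I \<noteq> {}"
  shows "prob_space.indep_vars (PiM I M) M (\<lambda>i x. x i) I"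
proof -
  interpret prob_space "PiM I M" by (rule prob_space_PiM) fact
  have "distr (PiM I M) (PiM I M) (\<lambda>x. \<lambda>i\<in>I. x i) = distr (PiM I M) (PiM I M) (\<lambda>x. x)"
    by (rule distr_cong) (auto simp: space_PiM)
  also have "\<dots> = PiM I (\<lambda>i. distr (PiM I M) (M i) (\<lambda>x. x i))"
    unfolding distr_id by (rule PiM_cong) (auto simp: distr_PiM_component assms)
  finally show ?thesis
    by (subst indep_vars_iff_distr_eq_PiM') (auto simp: assms)
qed

text \<open>Since \<open>0 powr b = 0\<close>, the density vanishes as soon as some coordinate does,
  for every choice of \<open>a\<close>. Strict positivity later ensures that no child is eventually
  abandoned.\<close>

lemma AE_dirichlet:
  assumes "d \<ge> 1"
  shows "AE u in dirichlet d a. u \<in> prob_simplex d \<and> (\<forall>j\<in>{1..d}. 0 < u j)"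
proof -
  have [measurable_cong]: "sets (hyperplane_measure d) = sets (\<Pi>\<^sub>M k\<in>{1..d}. borel)"
    by (simp add: hyperplane_measure_def)
  note [measurable] = measurable_dirichlet_density[of d a]
  show ?thesis unfolding dirichlet_def
  proof (subst AE_density, measurable, rule AE_I2, rule impI)
    fix u assume pos: "0 < ennreal (indicator (prob_simplex d) u * (1 / multi_beta d a) * (\<Prod>k=1..d. u k powr (a k - 1)))"
    have "u \<in> prob_simplex d" using pos by (cases "u \<in> prob_simplex d") auto
    moreover have "u j \<noteq> 0" if "j \<in> {1..d}" for j
    proof
      assume "u j = 0"
      then have "(\<Prod>k=1..d. u k powr (a k - 1)) = 0" using that by (intro prod_zero) auto
      from pos[unfolded this] show False by simp
    qed
    ultimately show "u \<in> prob_simplex d \<and> (\<forall>j\<in>{1..d}. 0 < u j)"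
      by (force simp: prob_simplex_def less_le)
  qed
qed

lemma prob_space_dirichlet:
  assumes "d \<ge> 1" "\<And>k. k \<in> {1..d} \<Longrightarrow> a k > 0"
  shows "prob_space (dirichlet d a)"
proof
  show "emeasure (dirichlet d a) (space (dirichlet d a)) = 1"
    using nn_integral_dirichlet_moment[of d a "\<lambda>_. 0"] multi_beta_pos[of d a] assms by simp
qed

text \<open>Quotients of Gamma values become rising factorials, the shape that telescopes over a
  tree.\<close>

lemma multi_beta_ratio:
  fixes a :: real
  assumes "a > 0" "d \<ge> 1"
  shows "multi_beta d (\<lambda>k. a + real (n k)) / multi_beta d (\<lambda>_. a)
    = (\<Prod>k=1..d. pochhammer a (n k)) / pochhammer (real d * a) (\<Sum>k=1..d. n k)"
proof -
  have nonpos: "x \<notin> \<int>\<^sub>\<le>\<^sub>0" if "x > 0" for x :: real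
    using that nonpos_Ints_nonpos by fastforce
  have da: "real d * a > 0" using assms by simp
  have "multi_beta d (\<lambda>k. a + real (n k)) / multi_beta d (\<lambda>_. a)
     = ((\<Prod>k=1..d. Gamma (a + real (n k))) / (\<Prod>k=1..d. Gamma a)) /
       (Gamma (real d * a + real (\<Sum>k=1..d. n k)) / Gamma (real d * a))"
    by (simp add: multi_beta_def sum.distrib)
  also have "(\<Prod>k=1..d. Gamma (a + real (n k))) / (\<Prod>k=1..d. Gamma a) = (\<Prod>k=1..d. pochhammer a (n k))"
    unfolding prod_dividef[symmetric] using nonpos[OF assms(1)] by (simp add: pochhammer_Gamma)
  also have "Gamma (real d * a + real (\<Sum>k=1..d. n k)) / Gamma (real d * a) = pochhammer (real d * a) (\<Sum>k=1..d. n k)"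
    using nonpos[OF da] by (simp add: pochhammer_Gamma)
  finally show ?thesis .
qed

text \<open>Inverse transform sampling: if \<open>v\<close> is uniform on the unit interval, then
  \<open>sample_child d u v\<close> equals \<open>j\<close> with probability \<open>u j\<close>.\<close>

definition sample_child :: "nat \<Rightarrow> (nat \<Rightarrow> real) \<Rightarrow> real \<Rightarrow> nat" where
  "sample_child d u v = Suc (card {j \<in> {1..<d}. (\<Sum>l=1..j. u l) \<le> v})"

definition unit_uniform :: "real measure" where
  "unit_uniform = uniform_measure lborel {0..<1}"

lemma sets_unit_uniform [measurable_cong, simp]: "sets unit_uniform = sets borel"
  by (simp add: unit_uniform_def)

lemma prob_space_unit_uniform: "prob_space unit_uniform"
  unfolding unit_uniform_def by (rule prob_space_uniform_measure) auto

text \<open>At most the \<open>d - 1\<close> inner partial sums are counted, so the result is a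
  legal child for all \<open>u\<close> and \<open>v\<close>. Hence routed trees are
  \<open>d\<close>-ary trees everywhere and not just almost everywhere.\<close>

lemma sample_child_in:
  assumes "d \<ge> 1"
  shows "sample_child d u v \<in> {1..d}"
proof -
  have "card {j \<in> {1..<d}. (\<Sum>l=1..j. u l) \<le> v} \<le> card {1..<d}" by (rule card_mono) auto
  then show ?thesis using assms by (simp add: sample_child_def)
qed

lemma measurable_sample_child [measurable (raw)]:
  assumes f: "f \<in> N \<rightarrow>\<^sub>M (\<Pi>\<^sub>M j\<in>{1..d}. borel)" and [measurable]: "g \<in> borel_measurable N"
  shows "(\<lambda>x. sample_child d (f x) (g x)) \<in> N \<rightarrow>\<^sub>M count_space UNIV"
proof -
  have comp [measurable]: "(\<lambda>x. f x l) \<in> borel_measurable N" if "l \<in> {1..d}" for l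
    using measurable_compose[OF f measurable_component_singleton[OF that]] by simp
  have "(\<lambda>x. card {j \<in> {1..<d}. (\<Sum>l=1..j. f x l) \<le> g x}) \<in> N \<rightarrow>\<^sub>M count_space UNIV"
  proof (rule measurable_card)
    fix j
    show "{x \<in> space N. j \<in> {j \<in> {1..<d}. (\<Sum>l=1..j. f x l) \<le> g x}} \<in> sets N"
    proof (cases "j \<in> {1..<d}")
      case True
      then have "(\<lambda>x. \<Sum>l=1..j. f x l) \<in> borel_measurable N" by (intro borel_measurable_sum comp) auto
      then show ?thesis using True by simp
    qed simp
  qed
  then show ?thesis unfolding sample_child_def by simp
qed

lemma measurable_sample_child_simplex:
  assumes "u \<in> prob_simplex d"
  shows "(\<lambda>v. sample_child d u v) \<in> borel \<rightarrow>\<^sub>M count_space UNIV"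
    and "{v. sample_child d u v = j} \<in> sets borel"
proof -
  have "u \<in> space (\<Pi>\<^sub>M j\<in>{1..d}. borel)"
    using assms by (auto simp: space_PiM prob_simplex_def PiE_def)
  then show meas: "(\<lambda>v. sample_child d u v) \<in> borel \<rightarrow>\<^sub>M count_space UNIV"
    by (intro measurable_sample_child measurable_const) auto
  from measurable_sets[OF meas, of "{j}"] show "{v. sample_child d u v = j} \<in> sets borel"
    by (simp add: vimage_def)
qed

lemma emeasure_sample_child:
  assumes u: "u \<in> prob_simplex d" and j: "j \<in> {1..d}"
  shows "emeasure unit_uniform {v. sample_child d u v = j} = ennreal (u j)"
proof -
  let ?S = "\<lambda>j. \<Sum>l=1..j. u l"
  have nonneg: "0 \<le> u l" if "l \<in> {1..d}" for l using u that by (simp add: prob_simplex_def)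
  have mono: "?S i \<le> ?S k" if "i \<le> k" "k \<le> d" for i k
    using that nonneg by (intro sum_mono2) auto
  have S_d: "?S d = 1" using u by (simp add: prob_simplex_def)
  have sampleI: "sample_child d u v = k" if k: "k \<in> {1..d}" "?S (k - 1) \<le> v" "v < ?S k" for k v
  proof -
    have "{j \<in> {1..<d}. ?S j \<le> v} = {1..<k}"
    proof (intro equalityI subsetI)
      fix i assume "i \<in> {j \<in> {1..<d}. ?S j \<le> v}"
      then show "i \<in> {1..<k}" using k mono[of k i] by (cases "i < k") auto
    next
      fix i assume i: "i \<in> {1..<k}"
      then have "i \<le> k - 1" "k - 1 \<le> d" using k(1) by auto
      from order_trans[OF mono[OF this] k(2)] show "i \<in> {j \<in> {1..<d}. ?S j \<le> v}" using k(1) i by auto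
    qed
    then show ?thesis using k by (simp add: sample_child_def)
  qed
  have "{0..<1} \<inter> {v. sample_child d u v = j} = {?S (j - 1)..<?S j}"
  proof (intro equalityI subsetI)
    fix v assume v: "v \<in> {0..<1} \<inter> {v. sample_child d u v = j}"
    \<comment> \<open>The first partial sum exceeding \<open>v\<close> selects the half-open
      interval that contains \<open>v\<close>; by \<open>sampleI\<close> its index is the sampled
      child, hence \<open>j\<close>.\<close>
    define k where "k = (LEAST k. v < ?S k)"
    have "v < ?S d" using v S_d by simp
    then have k: "v < ?S k" "k \<le> d" unfolding k_def by (auto intro: LeastI Least_le)
    have "k \<noteq> 0" using k(1) v by (intro notI) simp
    moreover have "\<not> v < ?S (k - 1)" using \<open>k \<noteq> 0\<close> unfolding k_def by (intro not_less_Least) simp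
    ultimately show "v \<in> {?S (j - 1)..<?S j}" using sampleI[of k v] k v by auto
  next
    fix v assume v: "v \<in> {?S (j - 1)..<?S j}"
    moreover have "?S 0 \<le> ?S (j - 1)" "?S j \<le> ?S d"
      using j mono[of 0 "j - 1"] mono[of j d] by auto
    ultimately have "0 \<le> v" "v < 1" using S_d by auto
    then show "v \<in> {0..<1} \<inter> {v. sample_child d u v = j}" using sampleI[of j v] v j by auto
  qed
  moreover have "?S j = ?S (j - 1) + u j" using j by (cases j) auto
  ultimately show ?thesis using nonneg[OF j] measurable_sample_child_simplex(2)[OF u]
    by (simp add: unit_uniform_def divide_ennreal_def)
qed

lemma space_dirichlet: "space (dirichlet d a) = space (\<Pi>\<^sub>M k\<in>{1..d}. borel)"
  by (rule sets_eq_imp_space_eq) simp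

section \<open>Draws at a single node\<close>

text \<open>Driving the draws by uniforms that are independent of the vector turns conditionally
  independent sampling into a plain product measure.\<close>

definition node_measure :: "nat \<Rightarrow> real \<Rightarrow> ((nat \<Rightarrow> real) \<times> (nat \<Rightarrow> real)) measure" where
  "node_measure d a = dirichlet d (\<lambda>_. a) \<Otimes>\<^sub>M (\<Pi>\<^sub>M k\<in>UNIV. unit_uniform)"

definition routing :: "nat \<Rightarrow> (nat \<Rightarrow> real) \<times> (nat \<Rightarrow> real) \<Rightarrow> nat \<Rightarrow> nat" where
  "routing d z k = sample_child d (fst z) (snd z k)"

lemma sets_node_measure [measurable_cong]:
  "sets (node_measure d a) = sets ((\<Pi>\<^sub>M j\<in>{1..d}. borel) \<Otimes>\<^sub>M (\<Pi>\<^sub>M k\<in>UNIV. borel))"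
  unfolding node_measure_def by (intro sets_pair_measure_cong sets_PiM_cong) auto

lemma measurable_routing [measurable]: "(\<lambda>z. routing d z k) \<in> node_measure d a \<rightarrow>\<^sub>M count_space UNIV"
  unfolding routing_def by measurable

context
  fixes d :: nat and a :: real
  assumes d: "d \<ge> 1" and a: "a > 0"
begin

interpretation D: prob_space "dirichlet d (\<lambda>_. a)"
  using d a by (intro prob_space_dirichlet) auto

interpretation V: prob_space "\<Pi>\<^sub>M k\<in>(UNIV :: nat set). unit_uniform"
  by (intro prob_space_PiM prob_space_unit_uniform)

interpretation DV: pair_prob_space "dirichlet d (\<lambda>_. a)" "\<Pi>\<^sub>M k\<in>(UNIV :: nat set). unit_uniform" ..

lemma prob_space_node_measure: "prob_space (node_measure d a)"
  unfolding node_measure_def by (rule DV.prob_space_axioms)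

text \<open>For a fixed vector \<open>u\<close> the draws are independent, so the event has as
  probability the monomial in \<open>u\<close> whose exponents are the counts; integrating it gives
  a Dirichlet moment. Only the counts matter, as in a Polya urn.\<close>

lemma emeasure_routing_prefix:
  assumes x: "\<And>k. x k \<in> {1..d}"
  shows "emeasure (node_measure d a) {z \<in> space (node_measure d a). \<forall>k<m. routing d z k = x k}
    = ennreal ((\<Prod>j=1..d. pochhammer a (card {k. k < m \<and> x k = j})) / pochhammer (real d * a) m)"
proof -
  let ?n = "\<lambda>j. card {k. k < m \<and> x k = j}"
  let ?V = "\<Pi>\<^sub>M k\<in>(UNIV :: nat set). unit_uniform"
  let ?E = "{z \<in> space (node_measure d a). \<forall>k<m. routing d z k = x k}"
  have E: "?E \<in> sets (node_measure d a)" by measurable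
  have inner: "emeasure ?V (Pair u -` ?E) = ennreal (\<Prod>j=1..d. u j ^ ?n j)" if u: "u \<in> prob_simplex d" for u
  proof -
    have nonneg: "0 \<le> u l" if "l \<in> {1..d}" for l using u that by (simp add: prob_simplex_def)
    have uD: "u \<in> space (dirichlet d (\<lambda>_. a))"
      using u by (auto simp: space_dirichlet prob_simplex_def space_PiM PiE_def)
    have S: "{v. sample_child d u v = j} \<in> sets unit_uniform" for j
      using measurable_sample_child_simplex(2)[OF u] by simp
    have "Pair u -` ?E = prod_emb UNIV (\<lambda>_. unit_uniform) {..<m} (PiE {..<m} (\<lambda>k. {v. sample_child d u v = x k}))"
      using uD by (auto simp: prod_emb_def node_measure_def space_pair_measure routing_def space_PiM PiE_iff)
    then have "emeasure ?V (Pair u -` ?E) = (\<Prod>k<m. emeasure unit_uniform {v. sample_child d u v = x k})"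
      using S by (simp add: emeasure_PiM_emb prob_space_unit_uniform)
    also have "\<dots> = ennreal (\<Prod>k<m. u (x k))"
      using x nonneg by (simp add: emeasure_sample_child[OF u] prod_ennreal del: atLeastAtMost_iff)
    also have "(\<Prod>k<m. u (x k)) = (\<Prod>j=1..d. \<Prod>k\<in>{k\<in>{..<m}. x k = j}. u (x k))"
      using x by (subst prod.group) auto
    also have "\<dots> = (\<Prod>j=1..d. u j ^ ?n j)"
      by (intro prod.cong refl) simp
    finally show ?thesis .
  qed
  have "emeasure (node_measure d a) ?E = (\<integral>\<^sup>+ u. emeasure ?V (Pair u -` ?E) \<partial>dirichlet d (\<lambda>_. a))"
    using E unfolding node_measure_def by (rule V.emeasure_pair_measure_alt)
  also have "\<dots> = (\<integral>\<^sup>+ u. ennreal (\<Prod>j=1..d. u j ^ ?n j) \<partial>dirichlet d (\<lambda>_. a))"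
  proof (rule nn_integral_cong_AE)
    show "AE u in dirichlet d (\<lambda>_. a). emeasure ?V (Pair u -` ?E) = ennreal (\<Prod>j=1..d. u j ^ ?n j)"
      using AE_dirichlet[OF d, of "\<lambda>_. a"] by eventually_elim (rule inner, simp)
  qed
  also have "\<dots> = ennreal ((\<Prod>j=1..d. pochhammer a (?n j)) / pochhammer (real d * a) m)"
    using d a x by (simp del: One_nat_def add: nn_integral_dirichlet_moment multi_beta_ratio sum_card_fibres)
  finally show ?thesis .
qed

lemma AE_sample_child_frequency:
  assumes u: "u \<in> prob_simplex d" and j: "j \<in> {1..d}"
  shows "AE v in \<Pi>\<^sub>M k\<in>UNIV. unit_uniform.
    (\<lambda>m. real (card {k. k < m \<and> sample_child d u (v k) = j}) / real m) \<longlonglongrightarrow> u j"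
proof -
  interpret unit: prob_space unit_uniform by (rule prob_space_unit_uniform)
  define f where "f = (indicator {v. sample_child d u v = j} :: real \<Rightarrow> real)"
  note [measurable] = measurable_sample_child_simplex(1)[OF u]
  have f [measurable]: "f \<in> borel_measurable borel"
    unfolding f_def using measurable_sample_child_simplex(2)[OF u] by (rule borel_measurable_indicator)
  have S: "{v. sample_child d u v = j} \<in> sets unit_uniform"
    using measurable_sample_child_simplex(2)[OF u] by simp
  have "V.indep_vars (\<lambda>_. borel) (\<lambda>k v. f (v k)) UNIV"
    by (rule V.indep_vars_compose2[OF indep_vars_PiM_component]) (auto simp: prob_space_unit_uniform)
  moreover have "V.expectation (\<lambda>v. f (v k)) = u j" for k
  proof -
    have "V.expectation (\<lambda>v. f (v k)) = integral\<^sup>L (distr (\<Pi>\<^sub>M k\<in>UNIV. unit_uniform) unit_uniform (\<lambda>v. v k)) f"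
      by (subst integral_distr) auto
    also have "\<dots> = integral\<^sup>L unit_uniform (indicator {v. sample_child d u v = j})"
      by (subst distr_PiM_component) (auto simp: prob_space_unit_uniform f_def)
    also have "\<dots> = measure unit_uniform {v. sample_child d u v = j}"
      using sets.sets_into_space[OF S] by (simp add: Int_absorb1)
    also have "\<dots> = u j"
      using emeasure_sample_child[OF u j] u j by (simp add: measure_def prob_simplex_def)
    finally show ?thesis .
  qed
  ultimately have "AE v in \<Pi>\<^sub>M k\<in>UNIV. unit_uniform. (\<lambda>m. (\<Sum>k<m. f (v k)) / real m) \<longlonglongrightarrow> u j"
    by (intro V.strong_law_unit_interval) (auto simp: f_def)
  moreover have "(\<Sum>k<m. f (v k)) = real (card {k. k < m \<and> sample_child d u (v k) = j})"
    for v :: "nat \<Rightarrow> real" and m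
  proof -
    have "(\<Sum>k<m. f (v k)) = (\<Sum>k\<in>{k. k < m \<and> sample_child d u (v k) = j}. 1)"
      by (rule sum.mono_neutral_cong_right) (auto simp: f_def)
    then show ?thesis by simp
  qed
  ultimately show ?thesis by simp
qed

text \<open>Fubini lifts the strong law from a frozen vector to the random one. This needs joint
  measurability of the convergence event, which is established first.\<close>

lemma AE_routing_frequency:
  "AE z in node_measure d a. \<forall>j\<in>{1..d}. 0 < fst z j \<and>
    (\<lambda>m. real (card {k. k < m \<and> routing d z k = j}) / real m) \<longlonglongrightarrow> fst z j"
  unfolding node_measure_def
proof (rule DV.AE_pair_measure)
  let ?P = "\<lambda>z. \<forall>j\<in>{1..d}. 0 < fst z j \<and>
    (\<lambda>m. real (card {k. k < m \<and> routing d z k = j}) / real m) \<longlonglongrightarrow> fst z j"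
  have fst: "fst \<in> node_measure d a \<rightarrow>\<^sub>M (\<Pi>\<^sub>M j\<in>{1..d}. borel)"
    by measurable
  have "{z \<in> space (node_measure d a). ?P z} \<in> sets (node_measure d a)"
  proof (intro sets.sets_Collect_finite_All sets.sets_Collect_conj finite_atLeastAtMost)
    fix j assume "j \<in> {1..d}"
    then have [measurable]: "(\<lambda>z. fst z j) \<in> borel_measurable (node_measure d a)"
      by (rule measurable_compose[OF fst measurable_component_singleton])
    show "{z \<in> space (node_measure d a). 0 < fst z j} \<in> sets (node_measure d a)"
      by measurable
    show "{z \<in> space (node_measure d a).
        (\<lambda>m. real (card {k. k < m \<and> routing d z k = j}) / real m) \<longlonglongrightarrow> fst z j} \<in> sets (node_measure d a)"
      by (rule predE[OF measurable_limit2]) measurable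
  qed
  then show "{z \<in> space (dirichlet d (\<lambda>_. a) \<Otimes>\<^sub>M Pi\<^sub>M UNIV (\<lambda>k. unit_uniform)). ?P z}
      \<in> sets (dirichlet d (\<lambda>_. a) \<Otimes>\<^sub>M Pi\<^sub>M UNIV (\<lambda>k. unit_uniform))"
    unfolding node_measure_def .
  show "AE u in dirichlet d (\<lambda>_. a). AE v in Pi\<^sub>M UNIV (\<lambda>k. unit_uniform). ?P (u, v)"
    using AE_dirichlet[OF d, of "\<lambda>_. a"]
  proof eventually_elim
    case (elim u)
    have "AE v in Pi\<^sub>M UNIV (\<lambda>k. unit_uniform). \<forall>j\<in>{1..d}.
       (\<lambda>m. real (card {k. k < m \<and> sample_child d u (v k) = j}) / real m) \<longlonglongrightarrow> u j"
      using elim by (intro AE_finite_allI AE_sample_child_frequency) auto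
    then show ?case
      by eventually_elim (use elim in \<open>simp add: routing_def\<close>)
  qed
qed

end

section \<open>Laws of discrete processes\<close>

text \<open>Countability extends the bound from points to all subsets, and applying it to
  complements reverses it because both total masses are one.\<close>

lemma (in prob_space) prob_space_eqI_countable:
  assumes N: "prob_space N" and sets: "sets M = Pow A" "sets N = Pow A" and A: "countable A"
    and le: "\<And>x. x \<in> A \<Longrightarrow> emeasure M {x} \<le> emeasure N {x}"
  shows "M = N"
proof (rule measure_eqI)
  interpret N: prob_space N by fact
  have space: "space M = A" "space N = A"
    using sets_eq_imp_space_eq[of M "count_space A"] sets_eq_imp_space_eq[of N "count_space A"] sets by simp_all
  have mono: "emeasure M B \<le> emeasure N B" if "B \<subseteq> A" for B
  proof -
    have B: "countable B" using that A by (rule countable_subset)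
    have "emeasure M B = (\<integral>\<^sup>+ x. emeasure M {x} \<partial>count_space B)"
      using that B sets by (intro emeasure_countable_singleton) auto
    also have "\<dots> \<le> (\<integral>\<^sup>+ x. emeasure N {x} \<partial>count_space B)"
      using that by (intro nn_integral_mono le) auto
    also have "\<dots> = emeasure N B"
      using that B sets by (intro emeasure_countable_singleton[symmetric]) auto
    finally show ?thesis .
  qed
  show "emeasure M B = emeasure N B" if "B \<in> sets M" for B
  proof -
    have B: "B \<subseteq> A" using that sets by auto
    have "prob (A - B) \<le> N.prob (A - B)"
      using mono[of "A - B"] by (simp add: emeasure_eq_measure N.emeasure_eq_measure)
    moreover have "prob (A - B) = 1 - prob B" "N.prob (A - B) = 1 - N.prob B"
      using prob_compl[of B] N.prob_compl[of B] that sets space by simp_all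
    moreover have "prob B \<le> N.prob B"
      using mono[OF B] by (simp add: emeasure_eq_measure N.emeasure_eq_measure)
    ultimately show ?thesis by (simp add: emeasure_eq_measure N.emeasure_eq_measure)
  qed
qed (simp add: sets)

lemma vimage_initial_segment:
  assumes "h \<in> PiE {..n} (\<lambda>_. C)"
  shows "(\<lambda>x. restrict (\<lambda>m. Z m x) {..n}) -` {h} \<inter> space K = {x \<in> space K. \<forall>m\<le>n. Z m x = h m}"
proof -
  have "restrict (\<lambda>m. Z m x) {..n} = h \<longleftrightarrow> (\<forall>m\<le>n. Z m x = h m)" for x
    using assms by (auto simp: fun_eq_iff restrict_def PiE_def extensional_def)
  then show ?thesis by auto
qed

lemma measurable_initial_segment:
  assumes C: "countable C" and Z: "\<And>n. Z n \<in> K \<rightarrow>\<^sub>M count_space C"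
  shows "(\<lambda>x. restrict (\<lambda>m. Z m x) {..n}) \<in> K \<rightarrow>\<^sub>M count_space (PiE {..n::nat} (\<lambda>_. C))"
proof -
  have sets: "{x \<in> space K. \<forall>m\<in>{..n}. Z m x = h m} \<in> sets K" if h: "h \<in> PiE {..n} (\<lambda>_. C)" for h
  proof (intro sets.sets_Collect_finite_All)
    fix m assume "m \<in> {..n}"
    then have "{h m} \<in> sets (count_space C)" using h by auto
    from measurable_sets[OF Z this, of m] have "Z m -` {h m} \<inter> space K \<in> sets K" .
    also have "Z m -` {h m} \<inter> space K = {x \<in> space K. Z m x = h m}" by auto
    finally show "{x \<in> space K. Z m x = h m} \<in> sets K" .
  qed (rule finite_atMost)
  have "countable (PiE {..n} (\<lambda>_. C))" using C by (intro countable_PiE) auto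
  then show ?thesis
  proof (subst measurable_count_space_eq_countable, goal_cases)
    case 2
    show ?case
    proof (intro conjI ballI funcsetI)
      fix x assume "x \<in> space K"
      then show "restrict (\<lambda>m. Z m x) {..n} \<in> PiE {..n} (\<lambda>_. C)"
        using measurable_space[OF Z, of x] by simp
    next
      fix h assume h: "h \<in> PiE {..n} (\<lambda>_. C)"
      show "(\<lambda>x. restrict (\<lambda>m. Z m x) {..n}) -` {h} \<inter> space K \<in> sets K"
        using sets[OF h] by (simp only: vimage_initial_segment[OF h] Ball_def atMost_iff)
    qed
  qed
qed

lemma measurable_path:
  assumes "\<And>n. Z n \<in> K \<rightarrow>\<^sub>M count_space C"
  shows "(\<lambda>x n. Z n x) \<in> K \<rightarrow>\<^sub>M (\<Pi>\<^sub>M n\<in>UNIV. count_space C)"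
  by (rule measurable_PiM_single') (use assms measurable_space[OF assms] in auto)

text \<open>A cylinder with indices up to \<open>n\<close> depends on the first \<open>n + 1\<close>
  entries of the path only, and these range over a countable space, where laws can be compared
  pointwise.\<close>

lemma emeasure_path_cylinder:
  assumes C: "countable C" and Z: "\<And>n. Z n \<in> K \<rightarrow>\<^sub>M count_space C"
    and J: "finite J" "J \<subseteq> {..n::nat}" and A: "\<And>i. i \<in> J \<Longrightarrow> A i \<in> sets (count_space C)"
  shows "emeasure (distr K (\<Pi>\<^sub>M n\<in>UNIV. count_space C) (\<lambda>x n. Z n x)) (prod_emb UNIV (\<lambda>_. count_space C) J (PiE J A))
    = emeasure (distr K (count_space (PiE {..n} (\<lambda>_. C))) (\<lambda>x. restrict (\<lambda>m. Z m x) {..n}))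
        {h \<in> PiE {..n} (\<lambda>_. C). \<forall>j\<in>J. h j \<in> A j}"
proof -
  have ZS: "(\<lambda>x n. Z n x) \<in> K \<rightarrow>\<^sub>M (\<Pi>\<^sub>M n\<in>UNIV. count_space C)"
    using Z by (rule measurable_path)
  have "(\<lambda>x n. Z n x) -` prod_emb UNIV (\<lambda>_. count_space C) J (PiE J A) \<inter> space K
     = (\<lambda>x. restrict (\<lambda>m. Z m x) {..n}) -` {h \<in> PiE {..n} (\<lambda>_. C). \<forall>j\<in>J. h j \<in> A j} \<inter> space K"
    using J(2) measurable_space[OF Z] by (auto simp: prod_emb_def PiE_iff subset_eq)
  moreover have "prod_emb UNIV (\<lambda>_. count_space C) J (PiE J A) \<in> sets (\<Pi>\<^sub>M n\<in>UNIV. count_space C)"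
    using J A by (intro sets_PiM_I) auto
  moreover have "{h \<in> PiE {..n} (\<lambda>_. C). \<forall>j\<in>J. h j \<in> A j} \<in> sets (count_space (PiE {..n} (\<lambda>_. C)))"
    by auto
  ultimately show ?thesis
    by (simp only: emeasure_distr[OF ZS] emeasure_distr[OF measurable_initial_segment[OF C Z]])
qed

lemma (in prob_space) distr_process_eqI:
  fixes X :: "nat \<Rightarrow> 'a \<Rightarrow> 'c" and Y :: "nat \<Rightarrow> 'b \<Rightarrow> 'c"
  assumes N: "prob_space N" and C: "countable C"
    and X: "\<And>n. X n \<in> M \<rightarrow>\<^sub>M count_space C" and Y: "\<And>n. Y n \<in> N \<rightarrow>\<^sub>M count_space C"
    and le: "\<And>n t. measure M {x \<in> space M. \<forall>m\<le>n. X m x = t m} \<le> measure N {x \<in> space N. \<forall>m\<le>n. Y m x = t m}"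
  shows "distr M (\<Pi>\<^sub>M n\<in>UNIV. count_space C) (\<lambda>x n. X n x) = distr N (\<Pi>\<^sub>M n\<in>UNIV. count_space C) (\<lambda>x n. Y n x)"
proof -
  interpret N: prob_space N by fact
  note XH = measurable_initial_segment[of C X M, OF C X]
  note YH = measurable_initial_segment[of C Y N, OF C Y]
  have eq: "distr M (count_space (PiE {..n} (\<lambda>_. C))) (\<lambda>x. restrict (\<lambda>m. X m x) {..n})
      = distr N (count_space (PiE {..n} (\<lambda>_. C))) (\<lambda>x. restrict (\<lambda>m. Y m x) {..n})" for n
  proof (rule prob_space.prob_space_eqI_countable[OF prob_space_distr[OF XH] N.prob_space_distr[OF YH]])
    show "countable (PiE {..n} (\<lambda>_. C))" using C by (intro countable_PiE) auto
    fix h assume h: "h \<in> PiE {..n} (\<lambda>_. C)"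
    then have h': "{h} \<in> sets (count_space (PiE {..n} (\<lambda>_. C)))" by simp
    show "emeasure (distr M (count_space (PiE {..n} (\<lambda>_. C))) (\<lambda>x. restrict (\<lambda>m. X m x) {..n})) {h}
      \<le> emeasure (distr N (count_space (PiE {..n} (\<lambda>_. C))) (\<lambda>x. restrict (\<lambda>m. Y m x) {..n})) {h}"
      unfolding emeasure_distr[OF XH h'] emeasure_distr[OF YH h'] vimage_initial_segment[OF h]
        emeasure_eq_measure N.emeasure_eq_measure
      by (rule ennreal_leI[OF le])
  qed (rule sets_distr[THEN trans], rule sets_count_space)+
  show ?thesis
  proof (rule measure_eqI_PiM_infinite)
    fix A and J :: "nat set" assume J: "finite J" and A: "\<And>i. i \<in> J \<Longrightarrow> A i \<in> sets (count_space C)"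
    from J obtain n where "\<forall>j\<in>J. j \<le> n" by (auto simp: finite_nat_set_iff_bounded_le)
    then have n: "J \<subseteq> {..n}" by auto
    show "emeasure (distr M (\<Pi>\<^sub>M n\<in>UNIV. count_space C) (\<lambda>x n. X n x)) (prod_emb UNIV (\<lambda>_. count_space C) J (PiE J A))
        = emeasure (distr N (\<Pi>\<^sub>M n\<in>UNIV. count_space C) (\<lambda>x n. Y n x)) (prod_emb UNIV (\<lambda>_. count_space C) J (PiE J A))"
      using emeasure_path_cylinder[of C X M J n A, OF C X J n A] emeasure_path_cylinder[of C Y N J n A, OF C Y J n A]
      by (simp only: eq)
  next
    interpret D: prob_space "distr M (\<Pi>\<^sub>M n\<in>UNIV. count_space C) (\<lambda>x n. X n x)"
      using X by (intro prob_space_distr measurable_path)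
    show "finite_measure (distr M (\<Pi>\<^sub>M n\<in>UNIV. count_space C) (\<lambda>x n. X n x))"
      by (rule D.finite_measure)
  qed (rule sets_distr)+
qed

text \<open>\<open>N\<close> and \<open>K\<close> need only share their sets: in the application
  \<open>N\<close> is the Dirichlet law and \<open>K\<close> the Borel product.\<close>

lemma (in prob_space) indep_vars_distr_PiM:
  assumes X: "\<And>i. i \<in> I \<Longrightarrow> X i \<in> M \<rightarrow>\<^sub>M K i" and I: "I \<noteq> {}"
    and N: "\<And>i. i \<in> I \<Longrightarrow> prob_space (N i)" "\<And>i. i \<in> I \<Longrightarrow> sets (N i) = sets (K i)"
    and eq: "distr M (PiM I K) (\<lambda>x. \<lambda>i\<in>I. X i x) = PiM I N"
  shows "indep_vars K X I" and "i \<in> I \<Longrightarrow> distr M (K i) (X i) = N i"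
proof -
  have XI: "(\<lambda>x. \<lambda>i\<in>I. X i x) \<in> M \<rightarrow>\<^sub>M PiM I K"
    using X by (rule measurable_restrict)
  have d: "distr M (K i) (X i) = N i" if i: "i \<in> I" for i
  proof -
    have "distr M (K i) (X i) = distr (distr M (PiM I K) (\<lambda>x. \<lambda>i\<in>I. X i x)) (K i) (\<lambda>f. f i)"
      using i by (subst distr_distr[OF measurable_component_singleton[OF i] XI]) (simp add: comp_def)
    also have "\<dots> = distr (PiM I N) (N i) (\<lambda>f. f i)"
      unfolding eq using N(2)[OF i] by (intro distr_cong) auto
    also have "\<dots> = N i" using N(1) i by (rule distr_PiM_component)
    finally show ?thesis .
  qed
  then show "i \<in> I \<Longrightarrow> distr M (K i) (X i) = N i" .
  have "(\<Pi>\<^sub>M i\<in>I. distr M (K i) (X i)) = PiM I N"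
    by (rule PiM_cong) (simp_all add: d)
  then show "indep_vars K X I"
    using eq by (subst indep_vars_iff_distr_eq_PiM'[OF I X]) simp_all
qed

section \<open>The routed tree process\<close>

definition forest_measure :: "nat \<Rightarrow> real \<Rightarrow> (nat list \<Rightarrow> (nat \<Rightarrow> real) \<times> (nat \<Rightarrow> real)) measure" where
  "forest_measure d a = (\<Pi>\<^sub>M i\<in>dary_words d. node_measure d a)"

definition sampled_tree :: "nat \<Rightarrow> nat \<Rightarrow> (nat list \<Rightarrow> (nat \<Rightarrow> real) \<times> (nat \<Rightarrow> real)) \<Rightarrow> nat list set" where
  "sampled_tree d n \<omega> = routed_tree d (\<lambda>i. routing d (\<omega> i)) n"

lemma routing_in: "d \<ge> 1 \<Longrightarrow> routing d z k \<in> {1..d}"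
  unfolding routing_def by (rule sample_child_in)

lemma sampled_tree_in_dary_trees: "d \<ge> 1 \<Longrightarrow> sampled_tree d n \<omega> \<in> dary_trees d"
  unfolding sampled_tree_def by (intro routed_tree_in_dary_trees routing_in)

lemma measurable_routed_size:
  assumes "i \<in> dary_words d"
  shows "(\<lambda>\<omega>. routed_size (\<lambda>i. routing d (\<omega> i)) m i) \<in> forest_measure d a \<rightarrow>\<^sub>M count_space UNIV"
  using assms
proof (induction i rule: rev_induct)
  case Nil
  then show ?case by simp
next
  case (snoc j i)
  then have i: "i \<in> dary_words d" and
    size [measurable]: "(\<lambda>\<omega>. routed_size (\<lambda>i. routing d (\<omega> i)) m i) \<in> forest_measure d a \<rightarrow>\<^sub>M count_space UNIV"
    by auto
  have [measurable]: "(\<lambda>\<omega>. routing d (\<omega> i) k) \<in> forest_measure d a \<rightarrow>\<^sub>M count_space UNIV" for k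
    unfolding forest_measure_def
    by (rule measurable_compose[OF measurable_component_singleton[OF i] measurable_routing])
  show ?case unfolding routed_size_simps
  proof (rule measurable_card)
    fix k
    show "{\<omega> \<in> space (forest_measure d a). k \<in> {k. k < routed_size (\<lambda>i. routing d (\<omega> i)) m i - 1 \<and>
        routing d (\<omega> i) k = j}} \<in> sets (forest_measure d a)"
      unfolding mem_Collect_eq by measurable
  qed
qed

text \<open>The state space is countable, so singletons suffice, and equality with \<open>t\<close>
  is a countable conjunction of conditions on sizes.\<close>

lemma measurable_sampled_tree:
  assumes d: "d \<ge> 1"
  shows "sampled_tree d n \<in> forest_measure d a \<rightarrow>\<^sub>M count_space (dary_trees d)"
proof (subst measurable_count_space_eq_countable[OF countable_dary_trees], intro conjI ballI funcsetI)
  fix \<omega> show "sampled_tree d n \<omega> \<in> dary_trees d" using d by (rule sampled_tree_in_dary_trees)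
next
  fix t assume "t \<in> dary_trees d"
  then have t: "t \<subseteq> dary_words d" by (simp add: dary_trees_def)
  let ?size = "\<lambda>\<omega> i. routed_size (\<lambda>i. routing d (\<omega> i)) (Suc n) i"
  have "sampled_tree d n \<omega> = t \<longleftrightarrow> (\<forall>i\<in>dary_words d. 0 < ?size \<omega> i \<longleftrightarrow> i \<in> t)" for \<omega>
    using t by (auto simp: sampled_tree_def routed_tree_def)
  then have "sampled_tree d n -` {t} \<inter> space (forest_measure d a)
    = {\<omega> \<in> space (forest_measure d a). \<forall>i\<in>dary_words d. 0 < ?size \<omega> i \<longleftrightarrow> i \<in> t}"
    by auto
  also have "\<dots> \<in> sets (forest_measure d a)"
    unfolding Ball_def
  proof (rule sets.sets_Collect_countable_All)
    fix i
    show "{\<omega> \<in> space (forest_measure d a). i \<in> dary_words d \<longrightarrow> (0 < ?size \<omega> i \<longleftrightarrow> i \<in> t)} \<in> sets (forest_measure d a)"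
    proof (cases "i \<in> dary_words d")
      case True
      note [measurable] = measurable_routed_size[OF True, of "Suc n" a]
      show ?thesis by measurable
    qed simp
  qed
  finally show "sampled_tree d n -` {t} \<inter> space (forest_measure d a) \<in> sets (forest_measure d a)" .
qed

lemma prob_space_forest_measure:
  assumes "d \<ge> 1" "a > 0"
  shows "prob_space (forest_measure d a)"
  unfolding forest_measure_def using assms by (intro prob_space_PiM prob_space_node_measure)

text \<open>Prescribing, at each node of \<open>t n\<close>, one draw fewer than its subtree size
  forces the whole history. Nodes are independent, so this event has a product probability, which
  \<open>prod_pochhammer_tree\<close> evaluates; \<open>da\<close> gives the Dirichlet normalizer
  its base \<open>a + 1\<close>.\<close>

lemma sampled_tree_history_prob:
  assumes d: "d \<ge> 1" and a: "a > 0" and da: "real d * a = a + 1" and hist: "growth_history d t n"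
  shows "a ^ n / pochhammer (a + 1) n
    \<le> measure (forest_measure d a) {\<omega> \<in> space (forest_measure d a). \<forall>m\<le>n. sampled_tree d m \<omega> = t m}"
proof -
  interpret F: prob_space "forest_measure d a" using d a by (rule prob_space_forest_measure)
  have tn: "t n \<in> dary_trees d" by (rule growth_history_dary_trees[OF hist order_refl])
  then have fin: "finite (t n)" and sub: "t n \<subseteq> dary_words d" by (auto simp: dary_trees_def)
  let ?s = "\<lambda>m i. card (subtree_at d (t m) i)"
  from growth_history_routing[OF hist d] obtain x where
    x: "\<forall>i k. x i k \<in> {1..d}" and
    x': "\<forall>m\<le>n. \<forall>i. \<forall>j\<in>{1..d}. card {k. k < ?s m i - 1 \<and> x i k = j} = ?s m (i @ [j])"
    by (elim exE conjE)
  let ?N = "node_measure d a"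
  let ?B = "\<lambda>i. {z \<in> space ?N. \<forall>k<?s n i - 1. routing d z k = x i k}"
  let ?E = "prod_emb (dary_words d) (\<lambda>_. ?N) (t n) (PiE (t n) ?B)"
  have B: "?B i \<in> sets ?N" for i by measurable
  have "emeasure (forest_measure d a) ?E = (\<Prod>i\<in>t n. emeasure ?N (?B i))"
    unfolding forest_measure_def using d a fin sub B by (intro emeasure_PiM_emb prob_space_node_measure)
  also have "\<dots> = (\<Prod>i\<in>t n. ennreal ((\<Prod>j=1..d. pochhammer a (?s n (i @ [j]))) / pochhammer (a + 1) (?s n i - 1)))"
  proof (rule prod.cong[OF refl])
    fix i assume "i \<in> t n"
    have "emeasure ?N (?B i) = ennreal ((\<Prod>j=1..d. pochhammer a (card {k. k < ?s n i - 1 \<and> x i k = j}))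
        / pochhammer (real d * a) (?s n i - 1))"
      using x by (intro emeasure_routing_prefix[OF d a]) simp
    also have "(\<Prod>j=1..d. pochhammer a (card {k. k < ?s n i - 1 \<and> x i k = j})) = (\<Prod>j=1..d. pochhammer a (?s n (i @ [j])))"
      using x' by (intro prod.cong refl) simp
    finally show "emeasure ?N (?B i) = ennreal ((\<Prod>j=1..d. pochhammer a (?s n (i @ [j]))) / pochhammer (a + 1) (?s n i - 1))"
      by (simp add: da)
  qed
  also have "\<dots> = ennreal (a ^ n / pochhammer (a + 1) n)"
  proof -
    have "0 \<le> (\<Prod>j=1..d. pochhammer a (?s n (i @ [j]))) / pochhammer (a + 1) (?s n i - 1)" for i
      using a by (intro divide_nonneg_pos prod_nonneg pochhammer_pos) (simp_all add: pochhammer_nonneg)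
    then show ?thesis
      using prod_pochhammer_tree[OF tn a] by (simp only: prod_ennreal card_growth_history[OF hist order_refl] diff_Suc_1)
  qed
  finally have "ennreal (F.prob ?E) = ennreal (a ^ n / pochhammer (a + 1) n)"
    by (simp only: F.emeasure_eq_measure)
  moreover have "0 \<le> a ^ n / pochhammer (a + 1) n"
    using a by (intro divide_nonneg_pos pochhammer_pos) simp_all
  ultimately have E: "F.prob ?E = a ^ n / pochhammer (a + 1) n"
    by (simp only: ennreal_inj measure_nonneg)
  have "?E \<subseteq> {\<omega> \<in> space (forest_measure d a). \<forall>m\<le>n. sampled_tree d m \<omega> = t m}"
  proof
    fix \<omega> assume \<omega>: "\<omega> \<in> ?E"
    have "sampled_tree d m \<omega> = t m" if m: "m \<le> n" for m
      unfolding sampled_tree_def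
    proof (rule routed_tree_eq_history[OF hist _ _ m])
      fix m i j assume "m \<le> n" "j \<in> {1..d}"
      then show "card {k. k < ?s m i - 1 \<and> x i k = j} = ?s m (i @ [j])" using x' by blast
    next
      fix i k assume "i \<in> t n" "k < ?s n i - 1"
      then show "routing d (\<omega> i) k = x i k" using \<omega> by (auto simp: prod_emb_def PiE_iff)
    qed
    then show "\<omega> \<in> {\<omega> \<in> space (forest_measure d a). \<forall>m\<le>n. sampled_tree d m \<omega> = t m}"
      using \<omega> by (auto simp: prod_emb_def forest_measure_def space_PiM)
  qed
  moreover have "{\<omega> \<in> space (forest_measure d a). \<forall>m\<in>{..n}. sampled_tree d m \<omega> = t m} \<in> sets (forest_measure d a)"
  proof (intro sets.sets_Collect_finite_All finite_atMost)
    fix m assume "m \<in> {..n}"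
    then have "{t m} \<in> sets (count_space (dary_trees d))"
      using growth_history_dary_trees[OF hist] by simp
    from measurable_sets[OF measurable_sampled_tree[OF d] this]
    have "sampled_tree d m -` {t m} \<inter> space (forest_measure d a) \<in> sets (forest_measure d a)" .
    also have "sampled_tree d m -` {t m} \<inter> space (forest_measure d a)
        = {\<omega> \<in> space (forest_measure d a). sampled_tree d m \<omega> = t m}" by auto
    finally show "{\<omega> \<in> space (forest_measure d a). sampled_tree d m \<omega> = t m} \<in> sets (forest_measure d a)" .
  qed
  ultimately show ?thesis
    unfolding E[symmetric] by (intro F.finite_measure_mono) (simp_all only: Ball_def atMost_iff)
qed

text \<open>By the chain rule the probability of a history is a product of kernel values, each
  depending on the number of nodes alone. Positive probability rules out all sequences that are not
  growth histories.\<close>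

lemma search_tree_process_history:
  assumes proc: "search_tree_process M d \<tau>" and d: "d \<ge> 2" and a: "a = 1 / (real d - 1)"
    and pos: "0 < measure M {\<omega> \<in> space M. \<forall>k\<le>n. \<tau> k \<omega> = t k}"
  shows "growth_history d t n \<and> measure M {\<omega> \<in> space M. \<forall>k\<le>n. \<tau> k \<omega> = t k} = a ^ n / pochhammer (a + 1) n"
  using pos
proof (induction n)
  interpret prob_space M using proc by (simp add: search_tree_process_def)
  have meas: "\<tau> n \<in> M \<rightarrow>\<^sub>M count_space (dary_trees d)" for n
    using proc by (simp add: search_tree_process_def)
  have transition: "\<P>(\<omega> in M. \<tau> (Suc n) \<omega> = t' \<bar> \<forall>k\<le>n. \<tau> k \<omega> = t k) = search_tree_kernel d (t n) t'"
    if "t' \<in> dary_trees d" "0 < \<P>(\<omega> in M. \<forall>k\<le>n. \<tau> k \<omega> = t k)" for n t t'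
  proof -
    from proc have "\<forall>n t. \<forall>t'\<in>dary_trees d. \<P>(\<omega> in M. \<forall>k\<le>n. \<tau> k \<omega> = t k) > 0 \<longrightarrow>
        \<P>(\<omega> in M. \<tau> (Suc n) \<omega> = t' \<bar> \<forall>k\<le>n. \<tau> k \<omega> = t k) = search_tree_kernel d (t n) t'"
      unfolding search_tree_process_def by (elim conjE)
    from this[rule_format, OF that] show ?thesis .
  qed
  {
    case 0
    have init: "AE \<omega> in M. \<tau> 0 \<omega> = {[]}" using proc by (simp add: search_tree_process_def)
    have t0: "t 0 = {[]}"
    proof (rule ccontr)
      assume "t 0 \<noteq> {[]}"
      then have "AE \<omega> in M. \<not> (\<forall>k\<le>0. \<tau> k \<omega> = t k)" by (intro eventually_mono[OF init]) auto
      then have "prob {\<omega> \<in> space M. \<forall>k\<le>0. \<tau> k \<omega> = t k} = 0"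
        by (intro prob_eq_0_AE)
      with 0 show False by simp
    qed
    have "prob {\<omega> \<in> space M. \<tau> 0 \<omega> = {[]}} = 1"
    proof (subst prob_Collect_eq_1)
      have "{[]} \<in> dary_trees d" by (auto simp: dary_trees_def)
      then have "{{[]}} \<in> sets (count_space (dary_trees d))" by simp
      from measurable_sets[OF meas this, of 0] have "\<tau> 0 -` {{[]}} \<inter> space M \<in> events" .
      also have "\<tau> 0 -` {{[]}} \<inter> space M = {\<omega> \<in> space M. \<tau> 0 \<omega> = {[]}}" by auto
      finally show "{\<omega> \<in> space M. \<tau> 0 \<omega> = {[]}} \<in> events" .
    qed (rule init)
    with t0 show ?case by (simp add: growth_history_def)
  next
    case (Suc n)
    let ?H = "\<lambda>n. {\<omega> \<in> space M. \<forall>k\<le>n. \<tau> k \<omega> = t k}"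
    \<comment> \<open>The sequence \<open>t\<close> is arbitrary; that its first terms are trees is
      learned from a sample point that realizes them.\<close>
    have "?H (Suc n) \<noteq> {}"
    proof
      assume empty: "?H (Suc n) = {}"
      show False using Suc.prems unfolding empty by simp
    qed
    then obtain \<omega> where \<omega>: "\<omega> \<in> ?H (Suc n)" by blast
    then have tin: "t k \<in> dary_trees d" if "k \<le> Suc n" for k
      using that measurable_space[OF meas, of \<omega> k] by auto
    have H: "{\<omega> \<in> space M. \<forall>k\<in>{..n}. \<tau> k \<omega> = t k} \<in> events"
    proof (intro sets.sets_Collect_finite_All finite_atMost)
      fix k assume "k \<in> {..n}"
      then have "{t k} \<in> sets (count_space (dary_trees d))" using tin by simp
      from measurable_sets[OF meas this, of k] have "\<tau> k -` {t k} \<inter> space M \<in> events" .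
      also have "\<tau> k -` {t k} \<inter> space M = {\<omega> \<in> space M. \<tau> k \<omega> = t k}" by auto
      finally show "{\<omega> \<in> space M. \<tau> k \<omega> = t k} \<in> events" .
    qed
    have "prob (?H (Suc n)) \<le> prob (?H n)"
      using H by (intro finite_measure_mono) (auto simp only: Ball_def atMost_iff intro: le_SucI)
    then have pos: "0 < prob (?H n)" using Suc.prems by simp
    note IH = Suc.IH[OF pos]
    then have hist: "growth_history d t n" by simp
    have "\<P>(\<omega> in M. \<tau> (Suc n) \<omega> = t (Suc n) \<bar> \<forall>k\<le>n. \<tau> k \<omega> = t k) = search_tree_kernel d (t n) (t (Suc n))"
      by (rule transition[OF tin[OF order_refl] pos])
    moreover have "{\<omega> \<in> space M. \<tau> (Suc n) \<omega> = t (Suc n) \<and> (\<forall>k\<le>n. \<tau> k \<omega> = t k)} = ?H (Suc n)"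
      unfolding atMost_iff[symmetric] atMost_Suc by auto
    ultimately have step: "prob (?H (Suc n)) = search_tree_kernel d (t n) (t (Suc n)) * prob (?H n)"
      using pos by (simp only: cond_prob_def) (simp add: divide_eq_eq)
    with Suc.prems have "search_tree_kernel d (t n) (t (Suc n)) \<noteq> 0" by auto
    then have grow: "growth_step d (t n) (t (Suc n))"
      and ker: "search_tree_kernel d (t n) (t (Suc n)) = 1 / (1 + (real d - 1) * real (card (t n)))"
      unfolding search_tree_kernel_def growth_step_def by (auto split: if_splits)
    \<comment> \<open>The tree has \<open>Suc n\<close> nodes. Dividing by \<open>real d - 1\<close>
      turns the number of free slots into \<open>a + 1 + real n\<close>, the next factor of
      \<open>pochhammer (a + 1)\<close>.\<close>
    have "1 / (1 + (real d - 1) * real (card (t n))) = a / (a + 1 + real n)"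
      using d card_growth_history[OF hist order_refl] by (simp add: a field_simps)
    then have "prob (?H (Suc n)) = a / (a + 1 + real n) * (a ^ n / pochhammer (a + 1) n)"
      using step ker IH by simp
    then show ?case using hist grow by (simp add: growth_history_Suc pochhammer_Suc mult_ac)
  }
qed

section \<open>Almost sure limits and the law of the weights\<close>

text \<open>The size at a child is the draw count at its parent, evaluated at the random number of
  draws made there. The strong law can be composed with this number once it tends to infinity, which
  is proved from the root down.\<close>

lemma AE_sampled_tree_ratio:
  assumes d: "d \<ge> 1" and a: "a > 0"
  shows "AE \<omega> in forest_measure d a. \<forall>i\<in>dary_words d. \<forall>j\<in>{1..d}.
    (\<lambda>n. real (card (subtree_at d (sampled_tree d n \<omega>) (i @ [j]))) /
         real (card (subtree_at d (sampled_tree d n \<omega>) i))) \<longlonglongrightarrow> fst (\<omega> i) j"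
proof -
  let ?cnt = "\<lambda>\<omega> i j m. card {k. k < m \<and> routing d (\<omega> i) k = j}"
  have "AE \<omega> in forest_measure d a. \<forall>i\<in>dary_words d. \<forall>j\<in>{1..d}. 0 < fst (\<omega> i) j \<and>
      (\<lambda>m. real (?cnt \<omega> i j m) / real m) \<longlonglongrightarrow> fst (\<omega> i) j"
    unfolding forest_measure_def
  proof (rule AE_ball_countable'[OF _ countable_dary_words])
    fix i assume "i \<in> dary_words d"
    then show "AE \<omega> in Pi\<^sub>M (dary_words d) (\<lambda>i. node_measure d a). \<forall>j\<in>{1..d}. 0 < fst (\<omega> i) j \<and>
      (\<lambda>m. real (?cnt \<omega> i j m) / real m) \<longlonglongrightarrow> fst (\<omega> i) j"
      by (rule AE_PiM_component[of _ "\<lambda>_. node_measure d a", OF prob_space_node_measure[OF d a] _ AE_routing_frequency[OF d a]])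
  qed
  then show ?thesis
  proof eventually_elim
    case (elim \<omega>)
    let ?size = "\<lambda>n i. routed_size (\<lambda>i. routing d (\<omega> i)) (Suc n) i"
    have size: "card (subtree_at d (sampled_tree d n \<omega>) i) = ?size n i" if "i \<in> dary_words d" for n i
      unfolding sampled_tree_def using that d by (intro card_subtree_at_routed_tree routing_in)
    have child: "?size n (i @ [j]) = ?cnt \<omega> i j (?size n i - 1)" for n i j
      by simp
    have freq: "(\<lambda>m. real (?cnt \<omega> i j m) / real m) \<longlonglongrightarrow> fst (\<omega> i) j" and pos: "0 < fst (\<omega> i) j"
      if "i \<in> dary_words d" "j \<in> {1..d}" for i j
      using elim that by blast+
    have pred: "filterlim (\<lambda>n. ?size n i - 1) at_top sequentially"
      if "filterlim (\<lambda>n. ?size n i) at_top sequentially" for i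
    proof -
      have "filterlim (\<lambda>n::nat. n - 1) at_top sequentially" by (rule filterlim_minus_const_nat_at_top)
      from filterlim_compose[OF this that] show ?thesis .
    qed
    have top: "filterlim (\<lambda>n. ?size n i) at_top sequentially" if "i \<in> dary_words d" for i
      using that
    proof (induction i rule: rev_induct)
      case Nil
      then show ?case by (simp add: filterlim_Suc)
    next
      case (snoc j i)
      then have i: "i \<in> dary_words d" and j: "j \<in> {1..d}" and
        IH: "filterlim (\<lambda>n. ?size n i) at_top sequentially" by auto
      \<comment> \<open>The count is frequency times number of draws, so a positive limiting
        frequency drives it to infinity.\<close>
      have "filterlim (\<lambda>m. real (?cnt \<omega> i j m) / real m * real m) at_top sequentially"
        by (rule filterlim_tendsto_pos_mult_at_top[OF freq[OF i j] pos[OF i j] filterlim_real_sequentially])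
      moreover have "real (?cnt \<omega> i j m) / real m * real m = real (?cnt \<omega> i j m)" for m
        by (cases m) simp_all
      ultimately have "filterlim (\<lambda>m. real (?cnt \<omega> i j m)) at_top sequentially"
        by simp
      then have "filterlim (\<lambda>m. ?cnt \<omega> i j m) at_top sequentially"
        by (simp add: filterlim_sequentially_iff_filterlim_real)
      from filterlim_compose[OF this pred[OF IH]] show ?case by (simp only: child)
    qed
    show ?case
    proof (intro ballI)
      fix i j assume i: "i \<in> dary_words d" and j: "j \<in> {1..d}"
      \<comment> \<open>The ratio divides by the full size at \<open>i\<close>, one more than the
        number of draws; a factor m/(m+1) absorbs the difference.\<close>
      have "(\<lambda>m. real (?cnt \<omega> i j m) / real m * (real m / real (Suc m))) \<longlonglongrightarrow> fst (\<omega> i) j * 1"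
        by (intro tendsto_mult freq[OF i j] LIMSEQ_n_over_Suc_n)
      moreover have "real (?cnt \<omega> i j m) / real m * (real m / real (Suc m)) = real (?cnt \<omega> i j m) / real (Suc m)" for m
        by (cases m) simp_all
      ultimately have "(\<lambda>m. real (?cnt \<omega> i j m) / real (Suc m)) \<longlonglongrightarrow> fst (\<omega> i) j" by simp
      from filterlim_compose[OF this pred[OF top[OF i]]]
      have "(\<lambda>n. real (?size n (i @ [j])) / real (Suc (?size n i - 1))) \<longlonglongrightarrow> fst (\<omega> i) j"
        by (simp only: child)
      \<comment> \<open>\<open>Suc\<close> undoes the truncated predecessor only for positive sizes,
        which hold for all large \<open>n\<close>.\<close>
      moreover have "\<forall>\<^sub>F n in sequentially. real (?size n (i @ [j])) / real (Suc (?size n i - 1))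
          = real (?size n (i @ [j])) / real (?size n i)"
      proof -
        have "\<forall>\<^sub>F n in sequentially. ?size n i > 0"
          by (rule eventually_compose_filterlim[OF eventually_gt_at_top top[OF i]])
        then show ?thesis by eventually_elim simp
      qed
      ultimately have "(\<lambda>n. real (?size n (i @ [j])) / real (?size n i)) \<longlonglongrightarrow> fst (\<omega> i) j"
        by (rule Lim_transform_eventually)
      then show "(\<lambda>n. real (card (subtree_at d (sampled_tree d n \<omega>) (i @ [j]))) /
         real (card (subtree_at d (sampled_tree d n \<omega>) i))) \<longlonglongrightarrow> fst (\<omega> i) j"
        using i j by (simp add: size del: routed_size_simps)
    qed
  qed
qed

lemma distr_forest_weights:
  assumes d: "d \<ge> 1" and a: "a > 0"
  shows "distr (forest_measure d a) (\<Pi>\<^sub>M i\<in>dary_words d. \<Pi>\<^sub>M j\<in>{1..d}. borel) (\<lambda>\<omega>. \<lambda>i\<in>dary_words d. fst (\<omega> i))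
    = (\<Pi>\<^sub>M i\<in>dary_words d. dirichlet d (\<lambda>_. a))"
proof -
  interpret F: prob_space "forest_measure d a" using d a by (rule prob_space_forest_measure)
  interpret V: prob_space "\<Pi>\<^sub>M k\<in>(UNIV :: nat set). unit_uniform"
    by (intro prob_space_PiM prob_space_unit_uniform)
  let ?K = "\<Pi>\<^sub>M j\<in>{1..d}. (borel :: real measure)"
  have fst: "fst \<in> node_measure d a \<rightarrow>\<^sub>M ?K" by measurable
  have comp: "(\<lambda>\<omega>. \<omega> i) \<in> forest_measure d a \<rightarrow>\<^sub>M node_measure d a" if "i \<in> dary_words d" for i
    unfolding forest_measure_def using that by (rule measurable_component_singleton)
  have X: "(\<lambda>\<omega>. fst (\<omega> i)) \<in> forest_measure d a \<rightarrow>\<^sub>M ?K" if "i \<in> dary_words d" for i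
    using measurable_compose[OF comp[OF that] fst] .
  have ne: "dary_words d \<noteq> {}" using dary_words_simps(1)[of d] by blast
  have "F.indep_vars (\<lambda>_. node_measure d a) (\<lambda>i \<omega>. \<omega> i) (dary_words d)"
    unfolding forest_measure_def using d a ne by (intro indep_vars_PiM_component prob_space_node_measure)
  then have "F.indep_vars (\<lambda>_. ?K) (\<lambda>i \<omega>. fst (\<omega> i)) (dary_words d)"
    by (rule F.indep_vars_compose2) (rule fst)
  then have "distr (forest_measure d a) (\<Pi>\<^sub>M i\<in>dary_words d. ?K) (\<lambda>\<omega>. \<lambda>i\<in>dary_words d. fst (\<omega> i))
    = (\<Pi>\<^sub>M i\<in>dary_words d. distr (forest_measure d a) ?K (\<lambda>\<omega>. fst (\<omega> i)))"
    by (subst (asm) F.indep_vars_iff_distr_eq_PiM'[OF ne X])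
  also have "\<dots> = (\<Pi>\<^sub>M i\<in>dary_words d. dirichlet d (\<lambda>_. a))"
  proof (rule PiM_cong[OF refl])
    fix i assume i: "i \<in> dary_words d"
    have "distr (forest_measure d a) ?K (\<lambda>\<omega>. fst (\<omega> i))
        = distr (distr (forest_measure d a) (node_measure d a) (\<lambda>\<omega>. \<omega> i)) ?K fst"
      by (simp only: distr_distr[OF fst comp[OF i]] comp_def)
    also have "distr (forest_measure d a) (node_measure d a) (\<lambda>\<omega>. \<omega> i) = node_measure d a"
      unfolding forest_measure_def using d a i by (intro distr_PiM_component prob_space_node_measure)
    \<comment> \<open>\<open>distr_pair_fst\<close> has the factor itself as target; the change is
      harmless because the sets agree.\<close>
    also have "distr (node_measure d a) ?K fst = distr (node_measure d a) (dirichlet d (\<lambda>_. a)) fst"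
      by (rule distr_cong) simp_all
    also have "\<dots> = dirichlet d (\<lambda>_. a)"
      unfolding node_measure_def by (rule V.distr_pair_fst)
    finally show "distr (forest_measure d a) ?K (\<lambda>\<omega>. fst (\<omega> i)) = dirichlet d (\<lambda>_. a)" .
  qed
  finally show ?thesis .
qed


theorem corollary4p2:
  fixes M :: "'a measure" and d :: nat and \<tau> :: "nat \<Rightarrow> 'a \<Rightarrow> nat list set"
  assumes "d \<ge> 2"
    and "search_tree_process M d \<tau>"
  shows "\<exists>U :: nat list \<Rightarrow> nat \<Rightarrow> 'a \<Rightarrow> real.
    prob_space.indep_vars M (\<lambda>i. \<Pi>\<^sub>M j\<in>{1..d}. borel) (\<lambda>i \<omega>. \<lambda>j\<in>{1..d}. U i j \<omega>) (dary_words d) \<and>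
    (\<forall>i\<in>dary_words d.
       distr M (\<Pi>\<^sub>M j\<in>{1..d}. borel) (\<lambda>\<omega>. \<lambda>j\<in>{1..d}. U i j \<omega>)
         = dirichlet d (\<lambda>_. 1 / (real d - 1))) \<and>
    (\<forall>i\<in>dary_words d. \<forall>j\<in>{1..d}. AE \<omega> in M.
       (\<lambda>n. real (card (subtree_at d (\<tau> n \<omega>) (i @ [j]))) / real (card (subtree_at d (\<tau> n \<omega>) i)))
         \<longlonglongrightarrow> U i j \<omega>)"
proof -
  interpret prob_space M using assms(2) by (simp add: search_tree_process_def)
  define a where "a = 1 / (real d - 1)"
  have d: "d \<ge> 1" and a: "a > 0" and da: "real d * a = a + 1"
    using assms(1) by (auto simp: a_def field_simps)
  let ?F = "forest_measure d a"
  let ?K = "\<Pi>\<^sub>M j\<in>{1..d}. (borel :: real measure)"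
  let ?S = "\<Pi>\<^sub>M n\<in>(UNIV :: nat set). count_space (dary_trees d)"
  interpret F: prob_space ?F using d a by (rule prob_space_forest_measure)
  have \<tau>: "\<tau> n \<in> M \<rightarrow>\<^sub>M count_space (dary_trees d)" for n
    using assms(2) by (simp add: search_tree_process_def)
  have \<tau>S: "(\<lambda>\<omega> n. \<tau> n \<omega>) \<in> M \<rightarrow>\<^sub>M ?S" and FS: "(\<lambda>\<omega> n. sampled_tree d n \<omega>) \<in> ?F \<rightarrow>\<^sub>M ?S"
    using \<tau> measurable_sampled_tree[OF d] by (auto intro!: measurable_path)
  have law: "distr M ?S (\<lambda>\<omega> n. \<tau> n \<omega>) = distr ?F ?S (\<lambda>\<omega> n. sampled_tree d n \<omega>)"
  proof (rule distr_process_eqI[OF F.prob_space_axioms countable_dary_trees \<tau> measurable_sampled_tree[OF d]])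
    fix n t
    show "prob {\<omega> \<in> space M. \<forall>m\<le>n. \<tau> m \<omega> = t m} \<le> F.prob {\<omega> \<in> space ?F. \<forall>m\<le>n. sampled_tree d m \<omega> = t m}"
    proof (cases "0 < prob {\<omega> \<in> space M. \<forall>m\<le>n. \<tau> m \<omega> = t m}")
      case True
      note hist = search_tree_process_history[OF assms(2,1) a_def True]
      from sampled_tree_history_prob[OF d a da conjunct1[OF hist]] show ?thesis
        by (simp only: conjunct2[OF hist])
    next
      case False
      then show ?thesis by (simp add: not_less measure_le_0_iff)
    qed
  qed
  define ratio where
    "ratio i j n p = real (card (subtree_at d (p n) (i @ [j]))) / real (card (subtree_at d (p n) i))"
    for i j n and p :: "nat \<Rightarrow> nat list set"
  \<comment> \<open>\<open>lim\<close> takes a default value on paths without a limit, so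
    \<open>L\<close> is defined, and measurable, on the whole path space.\<close>
  define L where "L i j p = lim (\<lambda>n. ratio i j n p)" for i j p
  have ratio [measurable]: "ratio i j n \<in> borel_measurable ?S" for i j n
  proof -
    have "(\<lambda>t. real (card (subtree_at d t (i @ [j]))) / real (card (subtree_at d t i)))
        \<in> count_space (dary_trees d) \<rightarrow>\<^sub>M borel" by simp
    moreover have "(\<lambda>p. p n) \<in> ?S \<rightarrow>\<^sub>M count_space (dary_trees d)"
      by (rule measurable_component_singleton) simp
    ultimately show ?thesis
      unfolding ratio_def[abs_def] by (rule measurable_compose[rotated])
  qed
  have L [measurable]: "L i j \<in> borel_measurable ?S" for i j
    unfolding L_def[abs_def] by measurable
  have row: "(\<lambda>p. \<lambda>j\<in>{1..d}. L i j p) \<in> ?S \<rightarrow>\<^sub>M ?K" for i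
    by (intro measurable_restrict L)
  have rows: "(\<lambda>p. \<lambda>i\<in>dary_words d. \<lambda>j\<in>{1..d}. L i j p) \<in> ?S \<rightarrow>\<^sub>M (\<Pi>\<^sub>M i\<in>dary_words d. ?K)"
    by (intro measurable_restrict row)
  have conv: "AE \<omega> in ?F. \<forall>i\<in>dary_words d. \<forall>j\<in>{1..d}.
      (\<lambda>n. ratio i j n (\<lambda>n. sampled_tree d n \<omega>)) \<longlonglongrightarrow> fst (\<omega> i) j"
    using AE_sampled_tree_ratio[OF d a] by (simp only: ratio_def)

  \<comment> \<open>Reading the weights off the observed path places them on \<open>M\<close>
    itself, while their joint law can be computed in the routed model.\<close>
  define U where "U i j \<omega> = L i j (\<lambda>n. \<tau> n \<omega>)" for i j \<omega>
  have U: "(\<lambda>\<omega>. \<lambda>j\<in>{1..d}. U i j \<omega>) \<in> M \<rightarrow>\<^sub>M ?K" for i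
    unfolding U_def by (rule measurable_compose[OF \<tau>S row])
  have "distr M (\<Pi>\<^sub>M i\<in>dary_words d. ?K) (\<lambda>\<omega>. \<lambda>i\<in>dary_words d. \<lambda>j\<in>{1..d}. U i j \<omega>)
    = distr (distr M ?S (\<lambda>\<omega> n. \<tau> n \<omega>)) (\<Pi>\<^sub>M i\<in>dary_words d. ?K) (\<lambda>p. \<lambda>i\<in>dary_words d. \<lambda>j\<in>{1..d}. L i j p)"
    by (simp only: distr_distr[OF rows \<tau>S] comp_def U_def)
  also have "\<dots> = distr ?F (\<Pi>\<^sub>M i\<in>dary_words d. ?K)
      (\<lambda>\<omega>. \<lambda>i\<in>dary_words d. \<lambda>j\<in>{1..d}. L i j (\<lambda>n. sampled_tree d n \<omega>))"
    by (simp only: law distr_distr[OF rows FS] comp_def)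
  also have "\<dots> = distr ?F (\<Pi>\<^sub>M i\<in>dary_words d. ?K) (\<lambda>\<omega>. \<lambda>i\<in>dary_words d. fst (\<omega> i))"
  proof (rule distr_cong_AE[OF refl refl])
    show "AE \<omega> in ?F. (\<lambda>i\<in>dary_words d. \<lambda>j\<in>{1..d}. L i j (\<lambda>n. sampled_tree d n \<omega>)) = (\<lambda>i\<in>dary_words d. fst (\<omega> i))"
      using conv AE_space
    proof eventually_elim
      case (elim \<omega>)
      \<comment> \<open>Outside {1..d} both functions are \<open>undefined\<close>: the Dirichlet
        law lives on extensional functions.\<close>
      have "(\<lambda>j\<in>{1..d}. L i j (\<lambda>n. sampled_tree d n \<omega>)) = fst (\<omega> i)" if i: "i \<in> dary_words d" for i
      proof
        fix j
        have "\<omega> i \<in> space (node_measure d a)"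
          using elim(2) i by (auto simp: forest_measure_def space_PiM)
        then have "fst (\<omega> i) \<in> extensional {1..d}"
          by (auto simp: node_measure_def space_pair_measure space_dirichlet space_PiM PiE_def)
        moreover have "L i j (\<lambda>n. sampled_tree d n \<omega>) = fst (\<omega> i) j" if "j \<in> {1..d}"
          unfolding L_def by (rule limI) (rule bspec[OF bspec[OF elim(1) i] that])
        ultimately show "(\<lambda>j\<in>{1..d}. L i j (\<lambda>n. sampled_tree d n \<omega>)) j = fst (\<omega> i) j"
          by (auto simp: restrict_def extensional_def)
      qed
      then show ?case by (intro restrict_ext)
    qed
    show "(\<lambda>\<omega>. \<lambda>i\<in>dary_words d. \<lambda>j\<in>{1..d}. L i j (\<lambda>n. sampled_tree d n \<omega>)) \<in> ?F \<rightarrow>\<^sub>M (\<Pi>\<^sub>M i\<in>dary_words d. ?K)"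
      by (rule measurable_compose[OF FS rows])
    show "(\<lambda>\<omega>. \<lambda>i\<in>dary_words d. fst (\<omega> i)) \<in> ?F \<rightarrow>\<^sub>M (\<Pi>\<^sub>M i\<in>dary_words d. ?K)"
    proof (rule measurable_restrict)
      fix i assume i: "i \<in> dary_words d"
      have fst: "fst \<in> node_measure d a \<rightarrow>\<^sub>M ?K" by measurable
      show "(\<lambda>\<omega>. fst (\<omega> i)) \<in> ?F \<rightarrow>\<^sub>M ?K"
        unfolding forest_measure_def by (rule measurable_compose[OF measurable_component_singleton[OF i] fst])
    qed
  qed
  also have "\<dots> = (\<Pi>\<^sub>M i\<in>dary_words d. dirichlet d (\<lambda>_. a))"
    by (rule distr_forest_weights[OF d a])
  finally have joint: "distr M (\<Pi>\<^sub>M i\<in>dary_words d. ?K) (\<lambda>\<omega>. \<lambda>i\<in>dary_words d. \<lambda>j\<in>{1..d}. U i j \<omega>)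
    = (\<Pi>\<^sub>M i\<in>dary_words d. dirichlet d (\<lambda>_. a))" .
  have ne: "dary_words d \<noteq> {}" using dary_words_simps(1)[of d] by blast
  have dir: "prob_space (dirichlet d (\<lambda>_. a))" using d a by (intro prob_space_dirichlet)
  note indep = indep_vars_distr_PiM[OF U ne dir sets_dirichlet joint]
  have "AE \<omega> in M. (\<lambda>n. ratio i j n (\<lambda>n. \<tau> n \<omega>)) \<longlonglongrightarrow> U i j \<omega>"
    if i: "i \<in> dary_words d" and j: "j \<in> {1..d}" for i j
  proof -
    \<comment> \<open>Convergence of the ratios to \<open>L\<close> is a measurable set of paths, so
      equality of the path laws carries its full measure over to the given process.\<close>
    have meas: "{p \<in> space ?S. (\<lambda>n. ratio i j n p) \<longlonglongrightarrow> L i j p} \<in> sets ?S"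
      by (rule predE[OF measurable_limit2]) (rule ratio L)+
    have "AE \<omega> in ?F. (\<lambda>n. ratio i j n (\<lambda>n. sampled_tree d n \<omega>)) \<longlonglongrightarrow> L i j (\<lambda>n. sampled_tree d n \<omega>)"
      using conv
    proof eventually_elim
      case (elim \<omega>)
      then have "(\<lambda>n. ratio i j n (\<lambda>n. sampled_tree d n \<omega>)) \<longlonglongrightarrow> fst (\<omega> i) j"
        by (rule bspec[OF bspec[OF _ i] j])
      moreover from this have "L i j (\<lambda>n. sampled_tree d n \<omega>) = fst (\<omega> i) j" unfolding L_def by (rule limI)
      ultimately show ?case by simp
    qed
    then have "AE p in distr M ?S (\<lambda>\<omega> n. \<tau> n \<omega>). (\<lambda>n. ratio i j n p) \<longlonglongrightarrow> L i j p"
      unfolding law AE_distr_iff[OF FS meas] .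
    then show ?thesis
      unfolding AE_distr_iff[OF \<tau>S meas] U_def .
  qed
  then show ?thesis
    using indep unfolding a_def ratio_def by (intro exI[of _ U] conjI ballI)
qed

end
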